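(* Let $\mathcal{P}$ be a closed path polyomino. Then the polyomino ideal $I_{\mathcal{P}}$ is of König type.
   Context: Cells and polyominoes: for $a=(i,j)\le b=(k,l)$ in $\mathbb{Z}^2$ (componentwise order), $[a,b]=\{(p,q)\in\mathbb{Z}^2: i\le p\le k,\ j\le q\le l\}$ is an interval; it is proper if $i<k$ and $j<l$. The diagonal corners of a proper interval are $a,b$ and its anti-diagonal corners are $c=(i,l)$, $d=(k,j)$. A cell is an interval $C=[a,a+(1,1)]$; $V(C)$ is the set of its four corners and its edges are its four sides. A polyomino $\mathcal{P}$ is a non-empty finite set of cells such that any two of its cells can be joined by a sequence of cells of $\mathcal{P}$ in which consecutive cells share an edge. $V(\mathcal{P})=\bigcup_{C\in\mathcal{P}}V(C)$. Polyomino ideal: a proper interval $[a,b]$ is an inner interval of $\mathcal{P}$ if every cell contained in $[a,b]$ belongs to $\mathcal{P}$. Let $K$ be a field and $S_{\mathcal{P}}=K[x_v: v\in V(\mathcal{P})]$. For an inner interval $[a,b]$ with anti-diagonal corners $c,d$, the binomial $x_ax_b-x_cx_d$ is an inner $2$-minor. $I_{\mathcal{P}}\subset S_{\mathcal{P}}$ is the ideal generated by all inner $2$-minors of $\mathcal{P}$. Closed path: a polyomino $\mathcal{P}$ is a closed path if its cells can be listed as $A_1,\dots,A_n$, $n>5$, with $A_{n+1}=A_1$ (indices modulo $n$), such that: $A_i\cap A_{i+1}$ is a common edge for all $i=1,\dots,n$; $A_i\ne A_j$ for $i\ne j$ in $\{1,\dots,n\}$; and for all $i$ and all $j\notin\{i-2,i-1,i,i+1,i+2\}$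 (indices modulo $n$) one has $V(A_i)\cap V(A_j)=\emptyset$. König type: a graded ideal $I$ of height $h$ in a polynomial ring $R=K[x_1,\dots,x_N]$ is of König type if there exist a sequence $f_1,\dots,f_h$ of homogeneous polynomials forming part of a minimal system of homogeneous generators of $I$ and a monomial order $<$ on $R$ such that the initial monomials $\mathrm{in}_<(f_1),\dots,\mathrm{in}_<(f_h)$ form a regular sequence. *)

theory Defs
  imports "HOL-Algebra.Ideal" "HOL-Library.Poly_Mapping" "HOL-Library.Extended_Nat"
begin

section \<open>Polynomial rings\<close>

text \<open>A polynomial is a finitely supported map from monomials to coefficients, a monomial being a
  finitely supported exponent vector. All variables live in an ambient type \<open>'v\<close>; the polynomial
  ring in the variables \<open>V\<close> is made a ring structure with explicit carrier, so that ideals,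
  primes and heights are those of $K[x_v : v \in V]$ and not of the ring on the whole type.\<close>

type_synonym 'v monomial = "'v \<Rightarrow>\<^sub>0 nat"
type_synonym ('v, 'k) mpoly = "('v \<Rightarrow>\<^sub>0 nat) \<Rightarrow>\<^sub>0 'k"

definition monomials :: "'v set \<Rightarrow> 'v monomial set" where
  "monomials V = {m. Poly_Mapping.keys m \<subseteq> V}"

definition poly_ring :: "'v set \<Rightarrow> ('v, 'k::field) mpoly ring" where
  "poly_ring V = \<lparr>carrier = {p. Poly_Mapping.keys p \<subseteq> monomials V},
     mult = (*), one = 1, zero = 0, add = (+)\<rparr>"

definition var :: "'v \<Rightarrow> ('v, 'k::field) mpoly" where
  "var v = Poly_Mapping.single (Poly_Mapping.single v 1) 1"

lemma poly_ring_simps [simp]: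
  "carrier (poly_ring V) = {p. Poly_Mapping.keys p \<subseteq> monomials V}"
  "p \<otimes>\<^bsub>poly_ring V\<^esub> q = p * q"
  "\<one>\<^bsub>poly_ring V\<^esub> = 1"
  "\<zero>\<^bsub>poly_ring V\<^esub> = 0"
  "p \<oplus>\<^bsub>poly_ring V\<^esub> q = p + q"
  by (simp_all add: poly_ring_def)

lemma zero_in_monomials: "0 \<in> monomials V"
  by (simp add: monomials_def)

lemma add_in_monomials: "m \<in> monomials V \<Longrightarrow> n \<in> monomials V \<Longrightarrow> m + n \<in> monomials V"
  using Poly_Mapping.keys_add[of m n] by (auto simp: monomials_def)

lemma mult_in_poly_ring:
  assumes "p \<in> carrier (poly_ring V)" "q \<in> carrier (poly_ring V)"
  shows "p * q \<in> carrier (poly_ring V)"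
proof -
  have "m + n \<in> monomials V"
    if "m \<in> Poly_Mapping.keys p" "n \<in> Poly_Mapping.keys q" for m n
    using assms that by (intro add_in_monomials) auto
  then show ?thesis
    using keys_mult[of p q] by auto
qed

lemma add_in_poly_ring:
  assumes "p \<in> carrier (poly_ring V)" "q \<in> carrier (poly_ring V)"
  shows "p + q \<in> carrier (poly_ring V)"
  using assms Poly_Mapping.keys_add[of p q] by auto

lemma uminus_in_poly_ring:
  "p \<in> carrier (poly_ring V) \<Longrightarrow> - p \<in> carrier (poly_ring V)"
  by simp

lemma var_in_poly_ring: "v \<in> V \<Longrightarrow> var v \<in> carrier (poly_ring V)"
  by (simp add: var_def monomials_def)

lemma cring_poly_ring: "cring (poly_ring V :: ('v, 'k::field) mpoly ring)"
proof (rule cringI)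
  show "abelian_group (poly_ring V :: ('v, 'k) mpoly ring)"
  proof (rule abelian_groupI)
    fix x :: "('v, 'k) mpoly"
    assume x: "x \<in> carrier (poly_ring V)"
    show "\<exists>y\<in>carrier (poly_ring V). y \<oplus>\<^bsub>poly_ring V\<^esub> x = \<zero>\<^bsub>poly_ring V\<^esub>"
      by (rule bexI[OF _ uminus_in_poly_ring[OF x]]) simp
  next
    fix x y :: "('v, 'k) mpoly"
    assume "x \<in> carrier (poly_ring V)" "y \<in> carrier (poly_ring V)"
    then show "x \<oplus>\<^bsub>poly_ring V\<^esub> y \<in> carrier (poly_ring V)"
      using add_in_poly_ring by (metis poly_ring_simps(5))
  qed (simp_all add: add.assoc add.commute)
  show "Group.comm_monoid (poly_ring V :: ('v, 'k) mpoly ring)"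
  proof (rule comm_monoidI)
    fix x y :: "('v, 'k) mpoly"
    assume "x \<in> carrier (poly_ring V)" "y \<in> carrier (poly_ring V)"
    then show "x \<otimes>\<^bsub>poly_ring V\<^esub> y \<in> carrier (poly_ring V)"
      using mult_in_poly_ring by (metis poly_ring_simps(2))
  qed (simp_all add: mult.assoc mult.commute zero_in_monomials)
qed (simp add: distrib_right)

section \<open>Height and regular sequences\<close>

definition prime_height :: "('a, 'b) ring_scheme \<Rightarrow> 'a set \<Rightarrow> enat" where
  "prime_height R p = Sup {enat n | n. \<exists>c :: nat \<Rightarrow> 'a set.
     (\<forall>i\<le>n. primeideal (c i) R) \<and> (\<forall>i<n. c i \<subset> c (Suc i)) \<and> c n = p}"

definition ideal_height :: "('a, 'b) ring_scheme \<Rightarrow> 'a set \<Rightarrow> enat" where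
  "ideal_height R I = Inf {prime_height R p | p. primeideal p R \<and> I \<subseteq> p}"

definition regular_sequence :: "('a, 'b) ring_scheme \<Rightarrow> 'a list \<Rightarrow> bool" where
  "regular_sequence R fs \<longleftrightarrow>
     set fs \<subseteq> carrier R \<and>
     (\<forall>i<length fs. \<forall>g\<in>carrier R.
        fs ! i \<otimes>\<^bsub>R\<^esub> g \<in> Idl\<^bsub>R\<^esub> (set (take i fs)) \<longrightarrow> g \<in> Idl\<^bsub>R\<^esub> (set (take i fs))) \<and>
     Idl\<^bsub>R\<^esub> (set fs) \<noteq> carrier R"

section \<open>Gradings, monomial orders and Koenig type\<close>

definition monomial_degree :: "'v monomial \<Rightarrow> nat" where
  "monomial_degree m = (\<Sum>v\<in>Poly_Mapping.keys m. Poly_Mapping.lookup m v)"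

definition homogeneous :: "('v, 'k::field) mpoly \<Rightarrow> bool" where
  "homogeneous f \<longleftrightarrow> (\<exists>d. \<forall>m\<in>Poly_Mapping.keys f. monomial_degree m = d)"

definition minimal_homogeneous_generators ::
  "'v set \<Rightarrow> ('v, 'k::field) mpoly set \<Rightarrow> ('v, 'k) mpoly set \<Rightarrow> bool" where
  "minimal_homogeneous_generators V I G \<longleftrightarrow>
     G \<subseteq> carrier (poly_ring V) \<and> finite G \<and> (\<forall>g\<in>G. homogeneous g) \<and>
     Idl\<^bsub>poly_ring V\<^esub> G = I \<and> (\<forall>G'. G' \<subset> G \<longrightarrow> Idl\<^bsub>poly_ring V\<^esub> G' \<noteq> I)"

text \<open>A pair \<open>(m, n)\<close> in the relation means that \<open>m\<close> is at most \<open>n\<close>; products of monomials are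
  sums of exponent vectors, and the monomial 1 is the exponent vector 0.\<close>

definition monomial_order :: "'v set \<Rightarrow> 'v monomial rel \<Rightarrow> bool" where
  "monomial_order V r \<longleftrightarrow>
     linear_order_on (monomials V) r \<and>
     (\<forall>m\<in>monomials V. (0, m) \<in> r) \<and>
     (\<forall>m n. \<forall>l\<in>monomials V. (m, n) \<in> r \<longrightarrow> (m + l, n + l) \<in> r)"

text \<open>The initial monomial, as a polynomial with coefficient 1; only meaningful for nonzero
  \<open>f\<close>, which members of a minimal generating system are.\<close>

definition initial_monomial :: "'v monomial rel \<Rightarrow> ('v, 'k::field) mpoly \<Rightarrow> ('v, 'k) mpoly" where
  "initial_monomial r f =
     Poly_Mapping.single
       (THE m. m \<in> Poly_Mapping.keys f \<and> (\<forall>n\<in>Poly_Mapping.keys f. (n, m) \<in> r)) 1"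

text \<open>The existence of homogeneous generators makes \<open>I\<close> a graded ideal.\<close>

definition konig_type :: "'v set \<Rightarrow> ('v, 'k::field) mpoly set \<Rightarrow> bool" where
  "konig_type V I \<longleftrightarrow>
     (\<exists>h fs G r.
        ideal_height (poly_ring V) I = enat h \<and>
        length fs = h \<and> distinct fs \<and> set fs \<subseteq> G \<and>
        minimal_homogeneous_generators V I G \<and>
        monomial_order V r \<and>
        regular_sequence (poly_ring V) (map (initial_monomial r) fs))"

section \<open>Polyominoes\<close>

type_synonym point = "int \<times> int"

definition grid_interval :: "point \<Rightarrow> point \<Rightarrow> point set" where
  "grid_interval a b = {(p, q). fst a \<le> p \<and> p \<le> fst b \<and> snd a \<le> q \<and> q \<le> snd b}"

definition proper_interval :: "point \<Rightarrow> point \<Rightarrow> bool" where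
  "proper_interval a b \<longleftrightarrow> fst a < fst b \<and> snd a < snd b"

definition cell :: "point \<Rightarrow> point set" where
  "cell a = grid_interval a (fst a + 1, snd a + 1)"

text \<open>A cell, being an interval of integer points, is equal to the set of its four corners.
  Hence the vertex set of a cell is the cell itself, and that of a collection of cells is its
  union.\<close>

lemma cell_eq_corners: "cell (i, j) = {(i, j), (i + 1, j), (i, j + 1), (i + 1, j + 1)}"
  by (auto simp: cell_def grid_interval_def)

definition vertices :: "point set set \<Rightarrow> point set" where
  "vertices P = \<Union>P"

definition edge_of :: "point set \<Rightarrow> point set \<Rightarrow> bool" where
  "edge_of E C \<longleftrightarrow> (\<exists>i j. C = cell (i, j) \<and>
     E \<in> {{(i, j), (i + 1, j)}, {(i, j + 1), (i + 1, j + 1)},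
          {(i, j), (i, j + 1)}, {(i + 1, j), (i + 1, j + 1)}})"

definition share_edge :: "point set \<Rightarrow> point set \<Rightarrow> bool" where
  "share_edge C D \<longleftrightarrow> (\<exists>E. edge_of E C \<and> edge_of E D)"

definition polyomino :: "point set set \<Rightarrow> bool" where
  "polyomino P \<longleftrightarrow>
     P \<noteq> {} \<and> finite P \<and> P \<subseteq> range cell \<and>
     (\<forall>C\<in>P. \<forall>D\<in>P. \<exists>Cs. Cs \<noteq> [] \<and> hd Cs = C \<and> last Cs = D \<and> set Cs \<subseteq> P \<and>
        (\<forall>i. Suc i < length Cs \<longrightarrow> share_edge (Cs ! i) (Cs ! Suc i)))"

text \<open>The cells $A_1, \dots, A_n$ are stored as \<open>A ! 0, \<dots>, A ! (n - 1)\<close>. Adding \<open>n\<close> before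
  subtracting keeps the cyclic predecessors correct on natural numbers.\<close>

definition closed_path :: "point set set \<Rightarrow> bool" where
  "closed_path P \<longleftrightarrow> polyomino P \<and>
     (\<exists>A n. length A = n \<and> n > 5 \<and> set A = P \<and> distinct A \<and>
        (\<forall>i<n. edge_of (A ! i \<inter> A ! ((i + 1) mod n)) (A ! i) \<and>
               edge_of (A ! i \<inter> A ! ((i + 1) mod n)) (A ! ((i + 1) mod n))) \<and>
        (\<forall>i<n. \<forall>j<n.
           j \<notin> {(i + n - 2) mod n, (i + n - 1) mod n, i, (i + 1) mod n, (i + 2) mod n} \<longrightarrow>
           vertices {A ! i} \<inter> vertices {A ! j} = {}))"

section \<open>The polyomino ideal\<close>

definition inner_interval :: "point set set \<Rightarrow> point \<Rightarrow> point \<Rightarrow> bool" where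
  "inner_interval P a b \<longleftrightarrow>
     proper_interval a b \<and> (\<forall>C\<in>range cell. C \<subseteq> grid_interval a b \<longrightarrow> C \<in> P)"

definition inner_minors :: "point set set \<Rightarrow> (point, 'k::field) mpoly set" where
  "inner_minors P =
     {var a * var b - var (fst a, snd b) * var (fst b, snd a) | a b. inner_interval P a b}"

definition polyomino_ideal :: "point set set \<Rightarrow> (point, 'k::field) mpoly set" where
  "polyomino_ideal P = Idl\<^bsub>poly_ring (vertices P)\<^esub> (inner_minors P)"

lemma inner_interval_corners:
  assumes "inner_interval P a b"
  shows "a \<in> vertices P" "b \<in> vertices P" "(fst a, snd b) \<in> vertices P" "(fst b, snd a) \<in> vertices P"
proof -
  obtain i j k l where ab: "a = (i, j)" "b = (k, l)" by (cases a, cases b)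
  have lt: "i < k" "j < l"
    using assms by (auto simp: inner_interval_def proper_interval_def ab)
  have *: "cell (p, q) \<in> P" if "i \<le> p" "p < k" "j \<le> q" "q < l" for p q
  proof -
    have "cell (p, q) \<subseteq> grid_interval a b"
      using that by (auto simp: cell_eq_corners grid_interval_def ab)
    then show ?thesis
      using assms by (auto simp: inner_interval_def)
  qed
  have v: "x \<in> vertices P" if "x \<in> cell (p, q)" "i \<le> p" "p < k" "j \<le> q" "q < l" for x p q
    using *[of p q] that by (auto simp: vertices_def)
  show "a \<in> vertices P"
    by (rule v[of _ i j]) (use lt in \<open>auto simp: ab cell_eq_corners\<close>)
  show "b \<in> vertices P"
    by (rule v[of _ "k - 1" "l - 1"]) (use lt in \<open>auto simp: ab cell_eq_corners\<close>)
  show "(fst a, snd b) \<in> vertices P"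
    by (rule v[of _ i "l - 1"]) (use lt in \<open>auto simp: ab cell_eq_corners\<close>)
  show "(fst b, snd a) \<in> vertices P"
    by (rule v[of _ "k - 1" j]) (use lt in \<open>auto simp: ab cell_eq_corners\<close>)
qed

lemma inner_minors_in_poly_ring:
  "inner_minors P \<subseteq> carrier (poly_ring (vertices P) :: (point, 'k::field) mpoly ring)"
proof
  fix f :: "(point, 'k) mpoly"
  assume "f \<in> inner_minors P"
  then obtain a b where "inner_interval P a b"
    and f: "f = var a * var b - var (fst a, snd b) * var (fst b, snd a)"
    by (auto simp: inner_minors_def)
  note c = inner_interval_corners[OF this(1), THEN var_in_poly_ring]
  show "f \<in> carrier (poly_ring (vertices P))"
    unfolding f diff_conv_add_uminus
    by (intro add_in_poly_ring uminus_in_poly_ring mult_in_poly_ring c)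
qed

lemma ideal_polyomino_ideal:
  "ideal (polyomino_ideal P :: (point, 'k::field) mpoly set) (poly_ring (vertices P))"
  unfolding polyomino_ideal_def
  by (intro ring.genideal_ideal cring.axioms(1) cring_poly_ring inner_minors_in_poly_ring)

end

theory Submission
  imports Defs "HOL-Algebra.Ring_Divisibility" "HOL-Library.Product_Lexorder"
begin

text \<open>The height of the polyomino ideal is the number \<open>n\<close> of cells. It is at most \<open>n\<close> for every
  polyomino: the vertices can be weighted in a lattice so that all inner minors become homogeneous and
  the vertices that are not the upper right corner of a cell get independent weights; the kernel
  of the corresponding map to Laurent polynomials is a prime above the ideal, and the vertices
  with independent weights are algebraically independent modulo it.

  For a closed path, walk through the cells and note that each cell adds two new vertices, the ends of
  its far edge. Carry one of them along, the one on the outer side of the last turn; the next cell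
  pairs it with one of its own two new vertices and carries the other. This
  gives \<open>n\<close> disjoint pairs of opposite corners of inner intervals, hence \<open>n\<close> inner minors.
  Giving every vertex that is not carried the same large weight, and the carried ones small weights that
  decrease along the path, makes the pairs initial monomials, provided that the path is cut at
  a turn where the other monomial consists of two carried vertices.

  Pairwise coprime initial monomials make the minors a regular sequence, so every prime above
  the ideal has height at least \<open>n\<close>.\<close>

section \<open>Heights and regular sequences\<close>

text \<open>The height has to be known exactly, and it is defined by chains of primes. For the lower
  bound every prime above the ideal needs a chain of its own. For the upper bound, a chain that is
  too long is refuted by counting: one element from each of its steps, together with the variables
  of independent weight, would give more linearly independent products than there are monomials with
  the exponents available.

  Regularity of a sequence with coprime leading monomials comes from a linear, not multiplicative,
  bijection of the polynomial ring under which multiplication by a leading monomial becomes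
  multiplication by the polynomial. Cancellation then only has to be checked for monomials.

  The cut of the path is forced. The initial monomial at a cell contains the vertex carried from the
  previous cell, the other monomial the vertex carried on. If these alone decided every comparison,
  weights would have to decrease strictly all around a cycle. So at one cell the comparison must be
  won differently, by the other monomial having no heavy vertex.\<close>

lemma (in cring) prime_ideal_disjoint_exists:
  assumes J: "ideal J R" and MJ: "M \<inter> J = {}" and Mc: "M \<subseteq> carrier R" and M1: "\<one> \<in> M"
    and Mm: "\<And>x y. x \<in> M \<Longrightarrow> y \<in> M \<Longrightarrow> x \<otimes> y \<in> M"
  shows "\<exists>q. primeideal q R \<and> J \<subseteq> q \<and> M \<inter> q = {}"
proof -
  define A where "A = {I. ideal I R \<and> J \<subseteq> I \<and> M \<inter> I = {}}"
  have "\<exists>q\<in>A. \<forall>X\<in>A. q \<subseteq> X \<longrightarrow> X = q"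
  proof (rule subset_Zorn_nonempty)
    show "A \<noteq> {}" using J MJ by (auto simp: A_def)
    fix C assume C: "C \<noteq> {}" "subset.chain A C"
    have "subset.chain {I. ideal I R} C"
      using C(2) by (auto simp: pred_on.chain_def A_def)
    from chain_Union_is_ideal[OF this] C(1) have "ideal (\<Union>C) R" by simp
    moreover have "J \<subseteq> X" "M \<inter> X = {}" if "X \<in> C" for X
      using C(2) that by (auto simp: pred_on.chain_def A_def)
    then have "J \<subseteq> \<Union>C" "M \<inter> \<Union>C = {}"
      using C(1) by blast+
    ultimately show "\<Union>C \<in> A" by (simp add: A_def)
  qed
  then obtain q where q: "q \<in> A" and qmax: "\<And>X. X \<in> A \<Longrightarrow> q \<subseteq> X \<Longrightarrow> X = q" by blast
  have qi: "ideal q R" and Jq: "J \<subseteq> q" and Mq: "M \<inter> q = {}" using q by (auto simp: A_def)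
  interpret q: ideal q R by (rule qi)
  \<comment> \<open>Maximality of \<open>q\<close>: enlarged by any further element
    \<open>a\<close>, it meets \<open>M\<close>. Two such meeting points multiply to an element of
    \<open>M\<close> that falls into \<open>q\<close> as soon as the product of the added elements
    does.\<close>
  have meet: "\<exists>y\<in>q. \<exists>r\<in>carrier R. y \<oplus> r \<otimes> a \<in> M" if a: "a \<in> carrier R" "a \<notin> q" for a
  proof -
    let ?X = "q <+>\<^bsub>R\<^esub> PIdl a"
    have X: "ideal ?X R" by (rule add_ideals[OF qi cgenideal_ideal[OF a(1)]])
    have X_eq: "?X = {y \<oplus> r \<otimes> a | y r. y \<in> q \<and> r \<in> carrier R}"
      by (auto simp: set_add_def' cgenideal_def)
    have qX: "q \<subseteq> ?X"
    proof
      fix y assume y: "y \<in> q"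
      then have "y = y \<oplus> \<zero> \<otimes> a" using a(1) q.Icarr by simp
      then show "y \<in> ?X" unfolding X_eq using y by blast
    qed
    have "a = \<zero> \<oplus> \<one> \<otimes> a" using a by simp
    then have "a \<in> ?X" unfolding X_eq using q.zero_closed by blast
    then have "?X \<noteq> q" using a by auto
    then have "?X \<notin> A" using qmax[OF _ qX] by blast
    then have "M \<inter> ?X \<noteq> {}" using X qX Jq by (auto simp: A_def)
    then show ?thesis unfolding X_eq by blast
  qed
  have "primeideal q R"
  proof (rule primeidealI[OF qi cring_axioms])
    show "carrier R \<noteq> q" using M1 Mq by auto
    fix a b assume ab: "a \<in> carrier R" "b \<in> carrier R" "a \<otimes> b \<in> q"
    show "a \<in> q \<or> b \<in> q"
    proof (rule ccontr)
      assume "\<not> (a \<in> q \<or> b \<in> q)"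
      then obtain y r z s where yr: "y \<in> q" "r \<in> carrier R" "y \<oplus> r \<otimes> a \<in> M"
        and zs: "z \<in> q" "s \<in> carrier R" "z \<oplus> s \<otimes> b \<in> M"
        using meet[of a] meet[of b] ab by blast
      have yz: "y \<in> carrier R" "z \<in> carrier R" using yr zs q.Icarr by auto
      have "(y \<oplus> r \<otimes> a) \<otimes> (z \<oplus> s \<otimes> b) = y \<otimes> (z \<oplus> s \<otimes> b) \<oplus> ((r \<otimes> a) \<otimes> z \<oplus> (r \<otimes> s) \<otimes> (a \<otimes> b))"
        using ab yr(2) zs(2) yz by (simp add: l_distr r_distr m_ac a_ac)
      also have "\<dots> \<in> q"
        using ab yr(1,2) zs(1,2) yz by (auto simp: q.I_l_closed q.I_r_closed intro!: q.a_closed)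
      finally show False using Mm[OF yr(3) zs(3)] Mq by blast
    qed
  qed
  then show ?thesis using Jq Mq by blast
qed

text \<open>The chain grows downwards from \<open>p\<close>. The last element \<open>f\<close>
  cancels modulo the ideal of the earlier ones, so that ideal misses all products of elements
  outside \<open>p\<close> with powers of \<open>f\<close>. A prime separated from these products
  lies in \<open>p\<close> and misses \<open>f\<close>; it is the top of a chain for the shorter
  sequence.\<close>

lemma (in cring) prime_chain_of_regular_sequence:
  assumes "set fs \<subseteq> carrier R"
    and "\<And>i g. i < length fs \<Longrightarrow> g \<in> carrier R \<Longrightarrow>
      fs ! i \<otimes> g \<in> Idl (set (take i fs)) \<Longrightarrow> g \<in> Idl (set (take i fs))"
    and "primeideal p R" and "set fs \<subseteq> p"
  shows "\<exists>c. (\<forall>i\<le>length fs. primeideal (c i) R) \<and> (\<forall>i<length fs. c i \<subset> c (Suc i)) \<and> c (length fs) = p"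
  using assms
proof (induction fs arbitrary: p rule: rev_induct)
  case Nil
  then show ?case by (intro exI[of _ "\<lambda>_. p"]) simp
next
  case (snoc f fs)
  interpret p: primeideal p R by (rule snoc.prems)
  let ?J = "Idl (set fs)"
  have fc: "f \<in> carrier R" and fsc: "set fs \<subseteq> carrier R" and fp: "f \<in> p" "set fs \<subseteq> p"
    using snoc.prems by auto
  have J: "ideal ?J R" by (rule genideal_ideal[OF fsc])
  have Jp: "?J \<subseteq> p" by (rule genideal_minimal[OF p.is_ideal fp(2)])
  have reg: "g \<in> ?J" if "g \<in> carrier R" "f \<otimes> g \<in> ?J" for g
    using snoc.prems(2)[of "length fs" g] that by simp
  define M where "M = {s \<otimes> f [^] k | s k. s \<in> carrier R - p \<and> (k::nat) \<in> UNIV}"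
  have "M \<inter> ?J = {}"
  proof -
    have "s \<in> ?J" if "s \<in> carrier R" "s \<otimes> f [^] (k::nat) \<in> ?J" for s k
      using that(2)
    proof (induction k)
      case 0
      then show ?case using that(1) by simp
    next
      case (Suc k)
      have "s \<otimes> f [^] Suc k = f \<otimes> (s \<otimes> f [^] k)"
        using that(1) fc by (simp add: m_ac)
      then show ?case using Suc reg[of "s \<otimes> f [^] k"] that(1) fc by simp
    qed
    then show ?thesis using Jp by (auto simp: M_def)
  qed
  moreover have "M \<subseteq> carrier R" using fc by (auto simp: M_def)
  moreover have pM: "carrier R - p \<subseteq> M"
  proof
    fix s assume s: "s \<in> carrier R - p"
    then have "s = s \<otimes> f [^] (0::nat)" by simp
    then show "s \<in> M" unfolding M_def using s by blast
  qed
  moreover have one: "\<one> \<in> carrier R - p"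
    using p.one_imp_carrier p.I_notcarr by auto
  moreover from pM one have "\<one> \<in> M" by (rule subsetD)
  moreover have "x \<otimes> y \<in> M" if "x \<in> M" "y \<in> M" for x y
  proof -
    obtain s k t l where xy: "x = s \<otimes> f [^] (k::nat)" "y = t \<otimes> f [^] (l::nat)"
      "s \<in> carrier R - p" "t \<in> carrier R - p"
      using \<open>x \<in> M\<close> \<open>y \<in> M\<close> by (auto simp: M_def)
    have "x \<otimes> y = (s \<otimes> t) \<otimes> f [^] (k + l)"
      using xy fc by (simp add: m_ac nat_pow_mult[symmetric])
    moreover have "s \<otimes> t \<in> carrier R - p" using xy p.I_prime by auto
    ultimately show ?thesis unfolding M_def by blast
  qed
  ultimately obtain q where q: "primeideal q R" "?J \<subseteq> q" "M \<inter> q = {}"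
    using prime_ideal_disjoint_exists[OF J, of M] by metis
  interpret q: primeideal q R by (rule q(1))
  have "q \<subseteq> p" using q(3) pM q.Icarr by blast
  moreover have "f \<notin> q"
  proof -
    have "f = \<one> \<otimes> f [^] (1::nat)" using fc by simp
    then have "f \<in> M" unfolding M_def using one by blast
    then show ?thesis using q(3) by blast
  qed
  ultimately have qp: "q \<subset> p" using fp by blast
  have "set fs \<subseteq> q" using q(2) genideal_self[OF fsc] by blast
  then obtain c where c: "\<forall>i\<le>length fs. primeideal (c i) R" "\<forall>i<length fs. c i \<subset> c (Suc i)"
    "c (length fs) = q"
    using snoc.IH[OF fsc _ q(1)] snoc.prems(2) by (force simp: nth_append)
  show ?case
  proof (rule exI[of _ "c(Suc (length fs) := p)"], intro conjI allI impI)
    fix i assume i: "i < length (fs @ [f])"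
    then show "(c(Suc (length fs) := p)) i \<subset> (c(Suc (length fs) := p)) (Suc i)"
      using c qp by (cases "i = length fs") auto
  qed (use c snoc.prems(3) in \<open>auto simp: le_Suc_eq\<close>)
qed

lemma (in cring) ideal_height_ge_regular_sequence:
  assumes "regular_sequence R fs" and "set fs \<subseteq> I"
  shows "enat (length fs) \<le> ideal_height R I"
  unfolding ideal_height_def
proof (rule Inf_greatest, clarify)
  fix p assume p: "primeideal p R" "I \<subseteq> p"
  have "\<exists>c. (\<forall>i\<le>length fs. primeideal (c i) R) \<and> (\<forall>i<length fs. c i \<subset> c (Suc i)) \<and> c (length fs) = p"
    using assms p by (intro prime_chain_of_regular_sequence) (auto simp: regular_sequence_def)
  then show "enat (length fs) \<le> prime_height R p"
    unfolding prime_height_def by (intro Sup_upper) blast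
qed

section \<open>Heights of primes in polynomial rings\<close>

lemma single_in_poly_ring: "m \<in> monomials V \<Longrightarrow> Poly_Mapping.single m c \<in> carrier (poly_ring V)"
  by simp

lemma sum_in_poly_ring:
  assumes "\<And>i. i \<in> A \<Longrightarrow> f i \<in> carrier (poly_ring V)"
  shows "sum f A \<in> carrier (poly_ring V)"
  using assms by (induction A rule: infinite_finite_induct) (auto intro!: add_in_poly_ring simp del: poly_ring_simps(1), simp_all)

lemma power_in_poly_ring:
  assumes "p \<in> carrier (poly_ring V)"
  shows "p ^ n \<in> carrier (poly_ring V)"
proof (induction n)
  case 0
  then show ?case by (simp add: zero_in_monomials)
next
  case (Suc n)
  show ?case unfolding power_Suc by (rule mult_in_poly_ring[OF assms Suc])
qed

lemma a_inv_poly_ring: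
  assumes "p \<in> carrier (poly_ring V)"
  shows "\<ominus>\<^bsub>poly_ring V\<^esub> p = - (p :: ('v, 'k::field) mpoly)"
proof -
  interpret cring "poly_ring V :: ('v, 'k) mpoly ring" by (rule cring_poly_ring)
  show ?thesis
    using minus_equality[of "- p" p] assms by simp
qed

text \<open>Closure under the arithmetic of the polynomial type, so that its ring laws can be used
  in membership proofs.\<close>

locale poly_ideal =
  fixes V :: "'v set" and I :: "('v, 'k::field) mpoly set"
  assumes ideal: "ideal I (poly_ring V)"
begin

lemma zero: "0 \<in> I"
  using additive_subgroup.zero_closed[OF ideal.axioms(1)[OF ideal]] by simp

lemma add: "x \<in> I \<Longrightarrow> y \<in> I \<Longrightarrow> x + y \<in> I"
  using additive_subgroup.a_closed[OF ideal.axioms(1)[OF ideal], of x y] by simp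

lemma mult: "x \<in> I \<Longrightarrow> r \<in> carrier (poly_ring V) \<Longrightarrow> r * x \<in> I"
  using ideal.I_l_closed[OF ideal, of x r] by simp

lemma uminus: "x \<in> I \<Longrightarrow> - x \<in> I"
  using mult[of x "- 1"] by (simp add: zero_in_monomials)

lemma diff: "x \<in> I \<Longrightarrow> y \<in> I \<Longrightarrow> x - y \<in> I"
  using add[of x "- y"] uminus by simp

lemma sum: "(\<And>i. i \<in> A \<Longrightarrow> f i \<in> I) \<Longrightarrow> Groups_Big.sum f A \<in> I"
  by (induction A rule: infinite_finite_induct) (auto intro: add zero)

end

lemma poly_idealI:
  fixes I :: "('v, 'k::field) mpoly set"
  assumes "I \<subseteq> carrier (poly_ring V)" "0 \<in> I"
    and "\<And>x y. x \<in> I \<Longrightarrow> y \<in> I \<Longrightarrow> x + y \<in> I"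
    and "\<And>r x. r \<in> carrier (poly_ring V) \<Longrightarrow> x \<in> I \<Longrightarrow> r * x \<in> I"
  shows "ideal I (poly_ring V)"
proof -
  interpret cring "poly_ring V :: ('v, 'k) mpoly ring" by (rule cring_poly_ring)
  have neg: "- x \<in> I" if "x \<in> I" for x
    using assms(4)[of "- 1" x] that by (simp add: zero_in_monomials)
  have inv: "\<ominus>\<^bsub>poly_ring V\<^esub> x \<in> I" if "x \<in> I" for x
    using a_inv_poly_ring[of x V] neg[OF that] that assms(1) by auto
  show ?thesis
  proof (rule idealI)
    show "subgroup I (add_monoid (poly_ring V))"
      by (rule add.subgroupI) (use assms inv in \<open>auto simp flip: a_inv_def\<close>)
  next
    fix x r :: "('v, 'k) mpoly" assume "x \<in> I" "r \<in> carrier (poly_ring V)"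
    then have "r * x \<in> I" by (intro assms(4))
    then show "r \<otimes>\<^bsub>poly_ring V\<^esub> x \<in> I" "x \<otimes>\<^bsub>poly_ring V\<^esub> r \<in> I"
      by (simp_all add: mult.commute)
  qed (rule ring_axioms)
qed

lemma primeideal_poly_ring_mult:
  assumes "primeideal q (poly_ring V)" "x \<in> carrier (poly_ring V)" "y \<in> carrier (poly_ring V)"
    and "x * y \<in> q"
  shows "x \<in> q \<or> y \<in> q"
  using primeideal.I_prime[OF assms(1), of x y] assms by simp

section \<open>Linear systems and the number of monomials with bounded exponents\<close>

lemma homogeneous_system_nontrivial_solution:
  fixes c :: "'b \<Rightarrow> 'i \<Rightarrow> 'k::field"
  assumes "finite B" "finite F" "card B < card F"
  shows "\<exists>x. (\<exists>i\<in>F. x i \<noteq> 0) \<and> (\<forall>b\<in>B. (\<Sum>i\<in>F. x i * c b i) = 0)"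
  using assms
proof (induction B arbitrary: F c rule: finite_induct)
  case empty
  then have "F \<noteq> {}" by auto
  then show ?case by (intro exI[of _ "\<lambda>_. 1"]) auto
next
  case (insert b B)
  show ?case
  proof (cases "\<forall>i\<in>F. c b i = 0")
    case True
    have "card B < card F" using insert by simp
    then show ?thesis using insert.IH[OF insert.prems(1), of c] True by auto
  next
    case False
    then obtain j where j: "j \<in> F" "c b j \<noteq> 0" by auto
    have "card B < card (F - {j})" using insert j by simp
    then obtain x where x: "\<exists>i\<in>F - {j}. x i \<noteq> 0"
      "\<And>a. a \<in> B \<Longrightarrow> (\<Sum>i\<in>F - {j}. x i * (c a i - c a j * (c b i / c b j))) = 0"
      using insert.IH[of "F - {j}" "\<lambda>a i. c a i - c a j * (c b i / c b j)"] insert.prems by auto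
    \<comment> \<open>The unknown \<open>j\<close> is eliminated through equation \<open>b\<close>,
      which forces the value \<open>- s\<close> on it.\<close>
    define s where "s = (\<Sum>i\<in>F - {j}. x i * (c b i / c b j))"
    define y where "y = x(j := - s)"
    have split: "(\<Sum>i\<in>F. y i * c a i) = (\<Sum>i\<in>F - {j}. x i * c a i) - s * c a j" for a
      using insert.prems(1) j by (simp add: sum.remove[of F j] y_def cong: sum.cong_simp)
    have "(\<Sum>i\<in>F. y i * c b i) = 0"
      unfolding split s_def using j(2) by (simp add: sum_distrib_right)
    moreover have "(\<Sum>i\<in>F. y i * c a i) = 0" if "a \<in> B" for a
    proof -
      have "(\<Sum>i\<in>F - {j}. x i * (c a i - c a j * (c b i / c b j)))
        = (\<Sum>i\<in>F - {j}. x i * c a i) - s * c a j"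
        unfolding s_def sum_distrib_right sum_subtractf[symmetric]
        by (rule sum.cong) (simp_all add: algebra_simps)
      then show ?thesis using x(2)[OF that] unfolding split by simp
    qed
    moreover have "\<exists>i\<in>F. y i \<noteq> 0" using x(1) by (auto simp: y_def)
    ultimately show ?thesis by (intro exI[of _ y]) auto
  qed
qed

text \<open>Exponents are bounded variable by variable rather than by total degree: the number of
  monomials is then exactly a power, and bounds add under multiplication.\<close>

definition monomial_box :: "'v set \<Rightarrow> nat \<Rightarrow> 'v monomial set" where
  "monomial_box V N = {m \<in> monomials V. \<forall>v. Poly_Mapping.lookup m v \<le> N}"

lemma bij_betw_monomial_box:
  assumes "finite V"
  shows "bij_betw (\<lambda>m. restrict (Poly_Mapping.lookup m) V) (monomial_box V N) (PiE V (\<lambda>_. {..N}))"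
proof (rule bij_betw_byWitness[where f' = "\<lambda>f. Abs_poly_mapping (\<lambda>v. if v \<in> V then f v else 0)"])
  have fin: "finite {v. (if v \<in> V then f v else 0) \<noteq> 0}" for f :: "'a \<Rightarrow> nat"
    by (rule finite_subset[OF _ assms]) (auto simp: when_def)
  note [simp] = lookup_Abs_poly_mapping[OF fin]
  show "\<forall>m\<in>monomial_box V N. Abs_poly_mapping (\<lambda>v. if v \<in> V then restrict (Poly_Mapping.lookup m) V v else 0) = m"
  proof
    fix m assume "m \<in> monomial_box V N"
    then have "(\<lambda>v. if v \<in> V then restrict (Poly_Mapping.lookup m) V v else 0) = Poly_Mapping.lookup m"
      by (auto simp: monomial_box_def monomials_def when_def in_keys_iff fun_eq_iff)
    then show "Abs_poly_mapping (\<lambda>v. if v \<in> V then restrict (Poly_Mapping.lookup m) V v else 0) = m"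
      by (simp add: lookup_inverse)
  qed
  show "\<forall>f\<in>PiE V (\<lambda>_. {..N}).
      restrict (Poly_Mapping.lookup (Abs_poly_mapping (\<lambda>v. if v \<in> V then f v else 0))) V = f"
    by (auto simp: fun_eq_iff restrict_def PiE_def extensional_def)
  show "(\<lambda>m. restrict (Poly_Mapping.lookup m) V) ` monomial_box V N \<subseteq> PiE V (\<lambda>_. {..N})"
    by (auto simp: monomial_box_def)
  show "(\<lambda>f. Abs_poly_mapping (\<lambda>v. if v \<in> V then f v else 0)) ` PiE V (\<lambda>_. {..N}) \<subseteq> monomial_box V N"
    by (auto simp: monomial_box_def monomials_def in_keys_iff PiE_def Pi_def split: if_splits)
qed

lemma
  assumes "finite V"
  shows finite_monomial_box: "finite (monomial_box V N)"
    and card_monomial_box: "card (monomial_box V N) = Suc N ^ card V"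
proof -
  note bij = bij_betw_monomial_box[OF assms, of N]
  show "finite (monomial_box V N)"
    using bij_betw_finite[OF bij] finite_PiE[OF assms, of "\<lambda>_. {..N}"] by simp
  show "card (monomial_box V N) = Suc N ^ card V"
    using bij_betw_same_card[OF bij] assms by (simp add: card_PiE)
qed

lemma monomial_box_add:
  assumes "m \<in> monomial_box V M" "n \<in> monomial_box V N"
  shows "m + n \<in> monomial_box V (M + N)"
  using assms by (auto simp: monomial_box_def lookup_add intro: add_in_monomials add_mono)

lemma monomial_box_mono: "M \<le> N \<Longrightarrow> monomial_box V M \<subseteq> monomial_box V N"
  by (auto simp: monomial_box_def intro: order_trans)

lemma keys_mult_monomial_box:
  assumes "Poly_Mapping.keys p \<subseteq> monomial_box V M" "Poly_Mapping.keys q \<subseteq> monomial_box V N"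
  shows "Poly_Mapping.keys (p * q) \<subseteq> monomial_box V (M + N)"
  using assms keys_mult[of p q] by (blast intro: monomial_box_add)

lemma keys_power_monomial_box:
  fixes p :: "('v, 'k::field) mpoly"
  assumes "Poly_Mapping.keys p \<subseteq> monomial_box V M"
  shows "Poly_Mapping.keys (p ^ n) \<subseteq> monomial_box V (n * M)"
proof (induction n)
  case 0
  then show ?case by (simp add: monomial_box_def zero_in_monomials)
next
  case (Suc n)
  show ?case using keys_mult_monomial_box[OF assms Suc] by simp
qed

lemma keys_sum_subset:
  assumes "\<And>i. i \<in> A \<Longrightarrow> Poly_Mapping.keys (f i) \<subseteq> B"
  shows "Poly_Mapping.keys (sum f A) \<subseteq> B"
  using assms
proof (induction A rule: infinite_finite_induct)
  case (insert x F)
  then show ?case using Poly_Mapping.keys_add[of "f x" "sum f F"] by auto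
qed auto

lemma poly_keys_in_monomial_box:
  fixes p :: "('v, 'k::field) mpoly"
  assumes "p \<in> carrier (poly_ring V)"
  shows "\<exists>N. Poly_Mapping.keys p \<subseteq> monomial_box V N"
proof -
  define N where "N = Sum (\<Union>m\<in>Poly_Mapping.keys p. Poly_Mapping.range m)"
  have "Poly_Mapping.lookup m v \<le> N" if "m \<in> Poly_Mapping.keys p" for m v
  proof (cases "v \<in> Poly_Mapping.keys m")
    case True
    then have "Poly_Mapping.lookup m v \<in> (\<Union>m\<in>Poly_Mapping.keys p. Poly_Mapping.range m)"
      using that by (intro UN_I) auto
    then show ?thesis unfolding N_def by (intro member_le_sum) auto
  qed (simp add: in_keys_iff)
  then show ?thesis using assms by (intro exI[of _ N]) (auto simp: monomial_box_def)
qed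

text \<open>The general element of the span of the products of a monomial in \<open>X\<close> with powers of the
  \<open>ys\<close> of exponents less than \<open>D\<close>.\<close>

fun combination :: "'v monomial set \<Rightarrow> nat \<Rightarrow> ('v, 'k::field) mpoly list \<Rightarrow>
    (nat list \<Rightarrow> 'v monomial \<Rightarrow> 'k) \<Rightarrow> ('v, 'k) mpoly" where
  "combination X D [] x = (\<Sum>m\<in>X. Poly_Mapping.single m (x [] m))"
| "combination X D (y # ys) x = (\<Sum>e<D. y ^ e * combination X D ys (\<lambda>es. x (e # es)))"

definition exponent_lists :: "nat \<Rightarrow> nat \<Rightarrow> nat list set" where
  "exponent_lists D k = {es. set es \<subseteq> {..<D} \<and> length es = k}"

lemma card_exponent_lists: "card (exponent_lists D k) = D ^ k"
  unfolding exponent_lists_def by (simp add: card_lists_length_eq)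

lemma finite_exponent_lists: "finite (exponent_lists D k)"
  unfolding exponent_lists_def by (rule finite_lists_length_eq) simp

lemma exponent_lists_Suc:
  "exponent_lists D (Suc k) = (\<lambda>(e, es). e # es) ` ({..<D} \<times> exponent_lists D k)"
  by (auto simp: exponent_lists_def length_Suc_conv image_iff)

lemma sum_exponent_lists_Suc:
  "(\<Sum>es\<in>exponent_lists D (Suc k). f es) = (\<Sum>e<D. \<Sum>es\<in>exponent_lists D k. f (e # es))"
proof -
  have inj: "inj_on (\<lambda>(e, es). e # es) A" for A :: "(nat \<times> nat list) set"
    by (auto simp: inj_on_def)
  show ?thesis
    unfolding exponent_lists_Suc sum.reindex[OF inj] by (simp add: sum.cartesian_product case_prod_unfold)
qed

text \<open>Makes visible that a combination is linear in the coefficients \<open>x\<close>, with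
  fixed multipliers; its vanishing is therefore a homogeneous linear system.\<close>

lemma combination_eq:
  "combination X D ys x = (\<Sum>es\<in>exponent_lists D (length ys). \<Sum>m\<in>X.
     Poly_Mapping.single m (x es m) * prod_list (map2 (^) ys es))"
proof (induction ys arbitrary: x)
  case Nil
  have "exponent_lists D 0 = {[]}" by (auto simp: exponent_lists_def)
  then show ?case by simp
next
  case (Cons y ys)
  show ?case
    by (simp add: Cons.IH sum_exponent_lists_Suc sum_distrib_left mult_ac)
qed

lemma combination_in_poly_ring:
  assumes "set ys \<subseteq> carrier (poly_ring V)" "X \<subseteq> monomials V"
  shows "combination X D ys x \<in> carrier (poly_ring V)"
  using assms
proof (induction ys arbitrary: x)
  case Nil
  then show ?case unfolding combination.simps by (intro sum_in_poly_ring single_in_poly_ring) auto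
next
  case (Cons y ys)
  then show ?case unfolding combination.simps
    by (intro sum_in_poly_ring mult_in_poly_ring power_in_poly_ring) auto
qed

lemma combination_zero:
  assumes "\<And>es m. es \<in> exponent_lists D (length ys) \<Longrightarrow> m \<in> X \<Longrightarrow> x es m = 0"
  shows "combination X D ys x = 0"
  unfolding combination_eq by (simp add: assms)

lemma lookup_single_mult:
  "Poly_Mapping.lookup (Poly_Mapping.single m c * p) b
    = c * Poly_Mapping.lookup (Poly_Mapping.single m 1 * (p :: ('v, 'k::field) mpoly)) b"
proof -
  have "Poly_Mapping.single m c * p = Poly_Mapping.single 0 c * (Poly_Mapping.single m 1 * p)"
    by (simp add: mult.assoc[symmetric] mult_single)
  also have "\<dots> = Poly_Mapping.map ((*) c) (Poly_Mapping.single m 1 * p)"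
    by (rule mult_map_scale_conv_mult[symmetric])
  finally show ?thesis by (simp add: Poly_Mapping.map.rep_eq when_def)
qed

text \<open>The lowest power of \<open>y\<^sub>0\<close> can be cancelled modulo the first prime; modulo the
  second one, which contains \<open>y\<^sub>0\<close>, only its cofactor survives.\<close>

lemma combination_independent:
  fixes c :: "nat \<Rightarrow> ('v, 'k::field) mpoly set"
  assumes "\<And>i. i \<le> length ys \<Longrightarrow> primeideal (c i) (poly_ring V)"
    and "\<And>i. i < length ys \<Longrightarrow> c i \<subseteq> c (Suc i)"
    and "\<And>i. i < length ys \<Longrightarrow> ys ! i \<in> c (Suc i) - c i"
    and "\<And>g. Poly_Mapping.keys g \<subseteq> monomials T \<Longrightarrow> g \<in> c (length ys) \<Longrightarrow> g = 0"
    and "T \<subseteq> V" and "X \<subseteq> monomials T" and "finite X"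
    and "combination X D ys x \<in> c 0"
    and "es \<in> exponent_lists D (length ys)" and "m \<in> X"
  shows "x es m = 0"
  using assms(1-4,8-10)
proof (induction ys arbitrary: c x es m)
  case Nil
  have "combination X D [] x = 0"
    using Nil assms(6) by (intro Nil(4)) (auto intro!: keys_sum_subset split: if_splits)
  moreover have "Poly_Mapping.lookup (combination X D [] x) m = x [] m"
    using Nil(7) assms(7) by (simp add: lookup_sum lookup_single when_def)
  ultimately show ?case using Nil(6) by (simp add: exponent_lists_def)
next
  case (Cons y ys)
  have XV: "X \<subseteq> monomials V" using assms(5,6) by (auto simp: monomials_def)
  have yc: "set (y # ys) \<subseteq> carrier (poly_ring V)"
  proof
    fix z assume "z \<in> set (y # ys)"
    then obtain i where "i < length (y # ys)" "z = (y # ys) ! i" by (metis in_set_conv_nth)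
    then show "z \<in> carrier (poly_ring V)"
      using Cons.prems(3)[of i] ideal.Icarr[OF primeideal.axioms(1)[OF Cons.prems(1)[of "Suc i"]]] by auto
  qed
  have pr: "primeideal (c 0) (poly_ring V)" "primeideal (c 1) (poly_ring V)"
    using Cons.prems(1)[of 0] Cons.prems(1)[of 1] by auto
  interpret c0: poly_ideal V "c 0" by (rule poly_ideal.intro[OF primeideal.axioms(1)[OF pr(1)]])
  interpret c1: poly_ideal V "c 1" by (rule poly_ideal.intro[OF primeideal.axioms(1)[OF pr(2)]])
  have y: "y \<in> c 1" "y \<notin> c 0" and c01: "c 0 \<subseteq> c 1"
    using Cons.prems(2,3)[of 0] by auto
  have IH: "z es m = 0"
    if "combination X D ys z \<in> c 1" "es \<in> exponent_lists D (length ys)" "m \<in> X" for z es m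
  proof (rule Cons.IH[where c = "\<lambda>i. c (Suc i)" and x = z])
    show "ys ! i \<in> c (Suc (Suc i)) - c (Suc i)" if "i < length ys" for i
      using Cons.prems(3)[of "Suc i"] that by simp
    show "g = 0" if "Poly_Mapping.keys g \<subseteq> monomials T" "g \<in> c (Suc (length ys))" for g
      using Cons.prems(4)[of g] that by simp
  qed (use Cons.prems(1,2) that in auto)
  \<comment> \<open>Stated for any \<open>d\<close> and any coefficients: cancelling a factor
    \<open>y\<close> shortens the sum by one term and shifts the coefficients by one.\<close>
  have *: "z e es m = 0"
    if "(\<Sum>e<d. y ^ e * combination X D ys (z e)) \<in> c 0" "e < d"
      "es \<in> exponent_lists D (length ys)" "m \<in> X" for d z e es m
    using that(1,2)
  proof (induction d arbitrary: z e)
    case (Suc d)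
    define S where "S = (\<Sum>e<d. y ^ e * combination X D ys (z (Suc e)))"
    have S: "S \<in> carrier (poly_ring V)"
      unfolding S_def using yc XV
      by (intro sum_in_poly_ring mult_in_poly_ring power_in_poly_ring combination_in_poly_ring) auto
    have eq: "(\<Sum>e<Suc d. y ^ e * combination X D ys (z e)) = combination X D ys (z 0) + S * y"
      unfolding S_def by (subst sum.lessThan_Suc_shift) (simp add: sum_distrib_left sum_distrib_right mult_ac)
    have "combination X D ys (z 0) + S * y \<in> c 1" using Suc.prems(1) c01 unfolding eq by blast
    from c1.diff[OF this c1.mult[OF y(1) S]] have "combination X D ys (z 0) \<in> c 1" by simp
    from IH[OF this] have z0: "z 0 es m = 0" if "es \<in> exponent_lists D (length ys)" "m \<in> X" for es m
      using that by simp
    have "combination X D ys (z 0) = 0"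
      by (rule combination_zero) (rule z0)
    then have "S * y \<in> c 0" using Suc.prems(1) unfolding eq by simp
    then have "S \<in> c 0"
      using primeideal_poly_ring_mult[OF pr(1) S, of y] y(2) yc by simp
    then show ?case
      using Suc.IH[of "\<lambda>e. z (Suc e)" "e - 1"] z0[OF that(3,4)] Suc.prems(2) unfolding S_def
      by (cases e) auto
  qed simp
  obtain e es' where es: "es = e # es'" "e < D" "es' \<in> exponent_lists D (length ys)"
    using Cons.prems(6) unfolding list.size exponent_lists_def by (cases es) auto
  show ?case
    using *[where d = D and z = "\<lambda>e es. x (e # es)"] Cons.prems(5,7) es by simp
qed

lemma keys_map2_power_monomial_box:
  fixes ys :: "('v, 'k::field) mpoly list"
  assumes "\<And>y. y \<in> set ys \<Longrightarrow> Poly_Mapping.keys y \<subseteq> monomial_box V N"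
    and "es \<in> exponent_lists D (length ys)"
  shows "Poly_Mapping.keys (prod_list (map2 (^) ys es)) \<subseteq> monomial_box V (length ys * (D * N))"
  using assms
proof (induction ys arbitrary: es)
  case Nil
  then show ?case by (simp add: monomial_box_def zero_in_monomials)
next
  case (Cons y ys)
  obtain e es' where es: "es = e # es'" "e < D" "es' \<in> exponent_lists D (length ys)"
    using Cons.prems(2) unfolding list.size exponent_lists_def by (cases es) auto
  have "Poly_Mapping.keys (y ^ e) \<subseteq> monomial_box V (e * N)"
    using Cons.prems(1) by (intro keys_power_monomial_box) simp
  also have "\<dots> \<subseteq> monomial_box V (D * N)"
    using es(2) by (intro monomial_box_mono) simp
  finally show ?case
    using keys_mult_monomial_box[OF _ Cons.IH[OF Cons.prems(1) es(3)]] es(1) by simp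
qed

text \<open>Along a chain of primes that is longer than \<open>|V| - |T|\<close>, more than
  \<open>|V|\<close> elements would be algebraically independent in the polynomial ring over \<open>V\<close>.\<close>

lemma prime_height_le:
  fixes p :: "('v, 'k::field) mpoly set"
  assumes V: "finite V" and T: "T \<subseteq> V"
    and indep: "\<And>g. Poly_Mapping.keys g \<subseteq> monomials T \<Longrightarrow> g \<in> p \<Longrightarrow> g = 0"
  shows "prime_height (poly_ring V) p \<le> enat (card V - card T)"
  unfolding prime_height_def
proof (rule Sup_least, clarify)
  fix k c
  assume c: "\<forall>i\<le>k. primeideal (c i) (poly_ring V)" "\<forall>i<k. c i \<subset> c (Suc i)" "p = c k"
  show "enat k \<le> enat (card V - card T)"
  proof (rule ccontr)
    assume "\<not> enat k \<le> enat (card V - card T)"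
    then have k: "Suc (card V) \<le> k + card T" using card_mono[OF V T] by simp
    have "\<forall>i<k. \<exists>y. y \<in> c (Suc i) - c i" using c(2) by blast
    then obtain y where y: "\<And>i. i < k \<Longrightarrow> y i \<in> c (Suc i) - c i" by metis
    define ys where "ys = map y [0..<k]"
    have len: "length ys = k" by (simp add: ys_def)
    have "\<exists>N. Poly_Mapping.keys (y i) \<subseteq> monomial_box V N" if "i < k" for i
      using y[OF that] c(1) that
      by (intro poly_keys_in_monomial_box ideal.Icarr[OF primeideal.axioms(1), of "c (Suc i)"]) auto
    then obtain N where N: "\<And>i. i < k \<Longrightarrow> Poly_Mapping.keys (y i) \<subseteq> monomial_box V (N i)" by metis
    define M where "M = sum N {..<k}"
    have M: "Poly_Mapping.keys z \<subseteq> monomial_box V M" if z: "z \<in> set ys" for z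
    proof -
      obtain i where i: "i < k" "z = y i" using z by (auto simp: ys_def)
      have "N i \<le> M" unfolding M_def using i by (intro member_le_sum) auto
      then show ?thesis using N[OF i(1)] monomial_box_mono[of "N i" M V] i by blast
    qed
    \<comment> \<open>There will be at least \<open>D ^ Suc (card V)\<close> unknowns, one for each
      exponent list and each monomial in \<open>X\<close>, and at most
      \<open>(D * (2 + k * M)) ^ card V\<close> equations, one for each monomial in
      \<open>B\<close>. This \<open>D\<close> makes the unknowns outnumber the equations.\<close>
    define D where "D = Suc ((2 + k * M) ^ card V)"
    define X where "X = monomial_box T (D - 1)"
    have finT: "finite T" using V T finite_subset by blast
    have X: "finite X" "X \<subseteq> monomials T" "card X = D ^ card T"
      using finite_monomial_box[OF finT] card_monomial_box[OF finT, of "D - 1"]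
      by (auto simp: X_def monomial_box_def D_def)
    \<comment> \<open>Exponents are at most \<open>D\<close> in the factor from \<open>X\<close> and
      at most \<open>D * M\<close> in each of the \<open>k\<close> powers.\<close>
    define B where "B = monomial_box V (D + k * (D * M))"
    define F where "F = exponent_lists D k \<times> X"
    have "card B \<le> (D * (2 + k * M)) ^ card V"
      unfolding B_def card_monomial_box[OF V]
      by (intro power_mono) (simp_all add: D_def algebra_simps)
    also have "\<dots> = D ^ card V * (2 + k * M) ^ card V" by (rule power_mult_distrib)
    also have "\<dots> < D ^ card V * D" by (simp add: D_def)
    also have "\<dots> = D ^ Suc (card V)" by simp
    also have "\<dots> \<le> D ^ (k + card T)" using k by (intro power_increasing) (auto simp: D_def)
    also have "\<dots> = card F"
      using X by (simp add: F_def card_cartesian_product card_exponent_lists power_add)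
    finally have card: "card B < card F" .
    have finF: "finite F" using X by (simp add: F_def finite_exponent_lists)
    obtain x where x: "\<exists>i\<in>F. x i \<noteq> 0"
      "\<And>b. b \<in> B \<Longrightarrow> (\<Sum>i\<in>F. x i * Poly_Mapping.lookup
         (Poly_Mapping.single (snd i) 1 * prod_list (map2 (^) ys (fst i))) b) = 0"
      using homogeneous_system_nontrivial_solution[OF finite_monomial_box[OF V] finF card[unfolded B_def],
        of "\<lambda>b i. Poly_Mapping.lookup (Poly_Mapping.single (snd i) 1 * prod_list (map2 (^) ys (fst i))) b"]
      unfolding B_def by blast
    have in_box: "Poly_Mapping.keys (Poly_Mapping.single m a * prod_list (map2 (^) ys es)) \<subseteq> B"
      if "es \<in> exponent_lists D k" "m \<in> X" for es m a
    proof -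
      have "Poly_Mapping.keys (Poly_Mapping.single m a) \<subseteq> monomial_box V D"
        using that(2) T by (auto simp: X_def D_def monomial_box_def monomials_def intro: le_trans)
      moreover have "Poly_Mapping.keys (prod_list (map2 (^) ys es)) \<subseteq> monomial_box V (k * (D * M))"
        using keys_map2_power_monomial_box[of ys V M es D] M that(1) by (simp add: len)
      ultimately show ?thesis unfolding B_def by (rule keys_mult_monomial_box)
    qed
    have zero: "combination X D ys (\<lambda>es m. x (es, m)) = 0"
    proof (rule poly_mapping_eqI)
      fix b
      show "Poly_Mapping.lookup (combination X D ys (\<lambda>es m. x (es, m))) b = Poly_Mapping.lookup 0 b"
      proof (cases "b \<in> B")
        case True
        then show ?thesis using x(2)[OF True]
          by (simp add: combination_eq len lookup_sum F_def sum.cartesian_product'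
              lookup_single_mult[of _ "x _"] case_prod_unfold)
      next
        case False
        have "Poly_Mapping.keys (combination X D ys (\<lambda>es m. x (es, m))) \<subseteq> B"
          unfolding combination_eq by (intro keys_sum_subset in_box) (auto simp: len)
        then show ?thesis using False by (auto simp: in_keys_iff)
      qed
    qed
    \<comment> \<open>The zero polynomial lies in the lowest prime of the chain, so independence
      forces all unknowns to vanish, against the choice of \<open>x\<close>.\<close>
    have "0 \<in> c 0"
      using additive_subgroup.zero_closed[OF ideal.axioms(1)[OF primeideal.axioms(1)], of "c 0" "poly_ring V"] c(1)
      by simp
    then have "x (es, m) = 0" if "es \<in> exponent_lists D k" "m \<in> X" for es m
      using combination_independent[of ys c V T X D "\<lambda>es m. x (es, m)" es m] c indep y X T that zero
      by (force simp: len ys_def)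
    then show False using x(1) by (auto simp: F_def)
  qed
qed

section \<open>Polynomials with coprime leading monomials\<close>

lemma poly_mapping_eq_sum_single:
  "p = (\<Sum>m\<in>Poly_Mapping.keys p. Poly_Mapping.single m (Poly_Mapping.lookup p m))"
  by (rule poly_mapping_eqI) (auto simp: lookup_sum lookup_single when_def in_keys_iff)

lemma pointwise_le_imp_add:
  fixes m u :: "'v monomial"
  assumes "\<And>v. Poly_Mapping.lookup u v \<le> Poly_Mapping.lookup m v"
  shows "m = (m - u) + u"
  by (rule poly_mapping_eqI) (simp add: lookup_add lookup_minus assms)

lemma add_in_monomials_iff: "m + n \<in> monomials V \<longleftrightarrow> m \<in> monomials V \<and> n \<in> monomials V"
proof -
  have "Poly_Mapping.keys (m + n) = Poly_Mapping.keys m \<union> Poly_Mapping.keys n"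
    by (auto simp: in_keys_iff lookup_add)
  then show ?thesis by (simp add: monomials_def)
qed

text \<open>The strict inequality also fixes the coefficient of \<open>m\<close> to be 1: otherwise
  \<open>m\<close> would survive in the difference.\<close>

definition leads :: "('v monomial \<Rightarrow> nat) \<Rightarrow> 'v monomial \<Rightarrow> ('v, 'k::field) mpoly \<Rightarrow> bool" where
  "leads W m p \<longleftrightarrow> (\<forall>k\<in>Poly_Mapping.keys (p - Poly_Mapping.single m 1). W k < W m)"

lemma keys_diff_subset:
  "Poly_Mapping.keys (p - q) \<subseteq> Poly_Mapping.keys p \<union> Poly_Mapping.keys (q :: 'a \<Rightarrow>\<^sub>0 'b::ab_group_add)"
  by (auto simp: in_keys_iff lookup_minus)

text \<open>Used twice: with \<open>f\<close> the binomials, for the lower bound on the height, and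
  with \<open>f\<close> the monomials \<open>u\<close> themselves, for the regular sequence of
  initial monomials.\<close>

locale leading_system =
  fixes V :: "'v set" and W :: "'v monomial \<Rightarrow> nat" and n :: nat
    and u :: "nat \<Rightarrow> 'v monomial" and f :: "nat \<Rightarrow> ('v, 'k::field) mpoly"
  assumes W_add: "W (a + b) = W a + W b"
    and u_monomial: "i < n \<Longrightarrow> u i \<in> monomials V"
    and u_nonzero: "i < n \<Longrightarrow> u i \<noteq> 0"
    and u_disjoint: "i < n \<Longrightarrow> j < n \<Longrightarrow> i \<noteq> j \<Longrightarrow> Poly_Mapping.keys (u i) \<inter> Poly_Mapping.keys (u j) = {}"
    and f_carrier: "i < n \<Longrightarrow> f i \<in> carrier (poly_ring V)"
    and f_leads: "i < n \<Longrightarrow> leads W (u i) (f i)"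
begin

lemma leads_mult:
  assumes "leads W a p" "leads W b q"
  shows "leads W (a + b) (p * q)"
proof -
  define r s where "r = p - Poly_Mapping.single a 1" and "s = q - Poly_Mapping.single b 1"
  have r: "W k < W a" if "k \<in> Poly_Mapping.keys r" for k using assms(1) that by (simp add: leads_def r_def)
  have s: "W k < W b" if "k \<in> Poly_Mapping.keys s" for k using assms(2) that by (simp add: leads_def s_def)
  have eq: "p * q - Poly_Mapping.single (a + b) 1 = Poly_Mapping.single a 1 * s + (r * Poly_Mapping.single b 1 + r * s)"
  proof -
    have "p = Poly_Mapping.single a 1 + r" "q = Poly_Mapping.single b 1 + s" by (simp_all add: r_def s_def)
    then show ?thesis by (simp add: algebra_simps mult_single)
  qed
  show ?thesis
    unfolding leads_def eq
  proof
    fix k assume "k \<in> Poly_Mapping.keys (Poly_Mapping.single a 1 * s + (r * Poly_Mapping.single b 1 + r * s))"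
    then consider "k \<in> Poly_Mapping.keys (Poly_Mapping.single a 1 * s)"
      | "k \<in> Poly_Mapping.keys (r * Poly_Mapping.single b 1)" | "k \<in> Poly_Mapping.keys (r * s)"
      using Poly_Mapping.keys_add[of "Poly_Mapping.single a 1 * s" "r * Poly_Mapping.single b 1 + r * s"]
        Poly_Mapping.keys_add[of "r * Poly_Mapping.single b 1" "r * s"] by blast
    then show "W k < W (a + b)"
    proof cases
      case 1
      then show ?thesis using s keys_mult[of "Poly_Mapping.single a 1" s] by (force simp: W_add)
    next
      case 2
      then show ?thesis using r keys_mult[of r "Poly_Mapping.single b 1"] by (force simp: W_add)
    next
      case 3
      then obtain x y where "k = x + y" "x \<in> Poly_Mapping.keys r" "y \<in> Poly_Mapping.keys s"
        using keys_mult[of r s] by blast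
      then show ?thesis using add_strict_mono[OF r s] by (simp add: W_add)
    qed
  qed
qed

lemma leads_single: "leads W a (Poly_Mapping.single a 1)"
  by (simp add: leads_def)

lemma leads_power: "leads W a p \<Longrightarrow> leads W (\<Sum>_<k. a) (p ^ k)"
proof (induction k)
  case 0
  then show ?case using leads_single[of 0] by simp
next
  case (Suc k)
  then show ?case using leads_mult[of a p "\<Sum>_<k. a" "p ^ k"] by (simp add: add.commute)
qed

lemma leads_prod:
  assumes "\<And>i. i \<in> A \<Longrightarrow> leads W (a i) (p i)"
  shows "leads W (sum a A) (prod p A)"
  using assms
proof (induction A rule: infinite_finite_induct)
  case (insert x A)
  then show ?case using leads_mult[of "a x" "p x" "sum a A" "prod p A"] by simp
qed (use leads_single[of 0] in simp_all)

text \<open>The exponent of the largest power of \<open>u i\<close> dividing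
  \<open>m\<close>.\<close>

definition exponent :: "nat \<Rightarrow> 'v monomial \<Rightarrow> nat" where
  "exponent i m = Min ((\<lambda>v. Poly_Mapping.lookup m v div Poly_Mapping.lookup (u i) v) ` Poly_Mapping.keys (u i))"

definition leading_part :: "'v monomial \<Rightarrow> 'v monomial" where
  "leading_part m = (\<Sum>i<n. \<Sum>_<exponent i m. u i)"

text \<open>As the \<open>u i\<close> share no variables, \<open>m\<close> splits into maximal
  powers of them and a remainder; each \<open>u i\<close> is exchanged for \<open>f i\<close> and
  the remainder is kept.\<close>

definition substituted :: "'v monomial \<Rightarrow> ('v, 'k) mpoly" where
  "substituted m = (\<Prod>i<n. f i ^ exponent i m) * Poly_Mapping.single (m - leading_part m) 1"

text \<open>Every quotient for \<open>u j\<close> itself rises by exactly one, and those for any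
  other \<open>u i\<close> stay, since no variable is shared.\<close>

lemma exponent_add:
  assumes "i < n" "j < n"
  shows "exponent i (m + u j) = exponent i m + (if i = j then 1 else 0)"
proof -
  let ?g = "\<lambda>v. Poly_Mapping.lookup m v div Poly_Mapping.lookup (u i) v"
  have ne: "Poly_Mapping.keys (u i) \<noteq> {}" using u_nonzero[OF assms(1)] by simp
  have "(\<lambda>v. Poly_Mapping.lookup (m + u j) v div Poly_Mapping.lookup (u i) v) ` Poly_Mapping.keys (u i)
    = (\<lambda>v. ?g v + (if i = j then 1 else 0)) ` Poly_Mapping.keys (u i)"
  proof (rule image_cong[OF refl])
    fix v assume v: "v \<in> Poly_Mapping.keys (u i)"
    then have "Poly_Mapping.lookup (u j) v = 0" if "i \<noteq> j"
      using u_disjoint[OF assms that] by (auto simp: in_keys_iff)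
    then show "Poly_Mapping.lookup (m + u j) v div Poly_Mapping.lookup (u i) v
      = ?g v + (if i = j then 1 else 0)"
      using v by (auto simp: lookup_add in_keys_iff)
  qed
  then show ?thesis
    unfolding exponent_def using Min_add_commute[OF finite_keys ne, of ?g] by simp
qed

lemma lookup_leading_part:
  "Poly_Mapping.lookup (leading_part m) v = (\<Sum>i<n. exponent i m * Poly_Mapping.lookup (u i) v)"
  by (simp add: leading_part_def lookup_sum)

lemma leading_part_add:
  assumes "j < n"
  shows "leading_part (m + u j) = leading_part m + u j"
proof (rule poly_mapping_eqI)
  fix v
  have "(\<Sum>i<n. exponent i (m + u j) * Poly_Mapping.lookup (u i) v)
    = (\<Sum>i<n. exponent i m * Poly_Mapping.lookup (u i) v + (if i = j then Poly_Mapping.lookup (u i) v else 0))"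
    by (rule sum.cong) (use assms in \<open>auto simp: exponent_add\<close>)
  also have "\<dots> = (\<Sum>i<n. exponent i m * Poly_Mapping.lookup (u i) v) + Poly_Mapping.lookup (u j) v"
    using assms by (simp add: sum.distrib)
  finally show "Poly_Mapping.lookup (leading_part (m + u j)) v = Poly_Mapping.lookup (leading_part m + u j) v"
    by (simp add: lookup_leading_part lookup_add)
qed

text \<open>A variable occurs in at most one \<open>u i\<close>, so at most one summand of its
  exponent is nonzero.\<close>

lemma leading_part_le: "Poly_Mapping.lookup (leading_part m) v \<le> Poly_Mapping.lookup m v"
proof (cases "\<exists>i<n. v \<in> Poly_Mapping.keys (u i)")
  case True
  then obtain i where i: "i < n" "v \<in> Poly_Mapping.keys (u i)" by blast
  have "(\<Sum>j<n. exponent j m * Poly_Mapping.lookup (u j) v) = (\<Sum>j\<in>{i}. exponent j m * Poly_Mapping.lookup (u j) v)"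
    by (rule sum.mono_neutral_right) (use i u_disjoint[of i] in \<open>auto simp: in_keys_iff disjoint_iff\<close>)
  moreover have "exponent i m \<le> Poly_Mapping.lookup m v div Poly_Mapping.lookup (u i) v"
    unfolding exponent_def using i by (intro Min_le) auto
  then have "exponent i m * Poly_Mapping.lookup (u i) v \<le> Poly_Mapping.lookup m v"
    by (metis div_times_less_eq_dividend mult_le_mono1 order_trans)
  ultimately show ?thesis by (simp add: lookup_leading_part)
next
  case False
  then have "(\<Sum>j<n. exponent j m * Poly_Mapping.lookup (u j) v) = 0"
    by (simp add: in_keys_iff)
  then show ?thesis unfolding lookup_leading_part by linarith
qed

lemma substituted_add:
  assumes "j < n"
  shows "substituted (m + u j) = f j * substituted m"
proof -
  have "(\<Prod>i<n. f i ^ exponent i (m + u j)) = (\<Prod>i<n. f i ^ exponent i m * (if i = j then f i else 1))"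
    by (rule prod.cong) (use assms in \<open>auto simp: exponent_add\<close>)
  also have "\<dots> = f j * (\<Prod>i<n. f i ^ exponent i m)"
    using assms by (simp add: prod.distrib)
  finally show ?thesis
    by (simp add: substituted_def leading_part_add[OF assms] mult_ac)
qed

lemma leads_substituted: "leads W m (substituted m)"
proof -
  have "leads W (leading_part m + (m - leading_part m)) (substituted m)"
    unfolding substituted_def
    by (intro leads_mult leads_single) (auto simp: leading_part_def intro!: leads_prod leads_power f_leads)
  then show ?thesis
    using pointwise_le_imp_add[of "leading_part m" m, OF leading_part_le] by (simp add: add.commute)
qed

lemma substituted_in_poly_ring:
  assumes "m \<in> monomials V"
  shows "substituted m \<in> carrier (poly_ring V)"
proof -
  have "m - leading_part m \<in> monomials V"
    using assms pointwise_le_imp_add[of "leading_part m" m, OF leading_part_le] add_in_monomials_iff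
    by metis
  moreover have "(\<Prod>i\<in>A. f i ^ exponent i m) \<in> carrier (poly_ring V)" if "A \<subseteq> {..<n}" for A
    using that
  proof (induction A rule: infinite_finite_induct)
    case (insert x F)
    then have "x < n" "(\<Prod>i\<in>F. f i ^ exponent i m) \<in> carrier (poly_ring V)" by auto
    then show ?case unfolding prod.insert[OF insert.hyps]
      by (intro mult_in_poly_ring power_in_poly_ring f_carrier)
  qed (simp_all add: zero_in_monomials)
  ultimately show ?thesis
    unfolding substituted_def by (intro mult_in_poly_ring single_in_poly_ring) auto
qed

text \<open>The linear automorphism that turns multiplication by the monomial \<open>u j\<close> into
  multiplication by \<open>f j\<close>; it is bijective as it is unitriangular with respect to \<open>W\<close>.\<close>

definition substitution :: "('v, 'k) mpoly \<Rightarrow> ('v, 'k) mpoly" where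
  "substitution p = (\<Sum>m\<in>Poly_Mapping.keys p. Poly_Mapping.single 0 (Poly_Mapping.lookup p m) * substituted m)"

lemma substitution_add: "substitution (p + q) = substitution p + substitution q"
  unfolding substitution_def
  by (rule setsum_keys_plus_distrib) (simp_all add: single_add distrib_right)

lemma substitution_zero: "substitution 0 = 0"
  by (simp add: substitution_def)

lemma substitution_sum: "substitution (sum p A) = (\<Sum>i\<in>A. substitution (p i))"
  by (induction A rule: infinite_finite_induct) (simp_all add: substitution_add substitution_zero)

lemma substitution_single: "substitution (Poly_Mapping.single m c) = Poly_Mapping.single 0 c * substituted m"
  by (simp add: substitution_def)

lemma substitution_mult_u:
  assumes "j < n"
  shows "substitution (Poly_Mapping.single (u j) 1 * p) = f j * substitution p"
proof -
  have "substitution (Poly_Mapping.single (u j) 1 * p)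
    = substitution (\<Sum>m\<in>Poly_Mapping.keys p. Poly_Mapping.single (m + u j) (Poly_Mapping.lookup p m))"
    by (subst (1) poly_mapping_eq_sum_single[of p]) (simp add: sum_distrib_left mult_single add.commute)
  also have "\<dots> = f j * substitution p"
    unfolding substitution_sum substitution_single substituted_add[OF assms]
    by (simp add: substitution_def sum_distrib_left mult_ac)
  finally show ?thesis .
qed

lemma substitution_in_poly_ring:
  assumes "p \<in> carrier (poly_ring V)"
  shows "substitution p \<in> carrier (poly_ring V)"
  unfolding substitution_def
  using assms
  by (intro sum_in_poly_ring mult_in_poly_ring substituted_in_poly_ring single_in_poly_ring zero_in_monomials) auto

text \<open>A monomial of \<open>p\<close> of maximal weight keeps its coefficient: apart from
  itself, each monomial only produces monomials of smaller weight than its own.\<close>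

lemma substitution_eq_0:
  assumes "substitution p = 0"
  shows "p = 0"
proof (rule ccontr)
  assume "p \<noteq> 0"
  then have ne: "Poly_Mapping.keys p \<noteq> {}" by simp
  obtain m where m: "m \<in> Poly_Mapping.keys p" "\<And>k. k \<in> Poly_Mapping.keys p \<Longrightarrow> W k \<le> W m"
    using Max_in[of "W ` Poly_Mapping.keys p"] Max_ge[of "W ` Poly_Mapping.keys p"] ne
    by (metis (no_types, lifting) finite_imageI finite_keys image_iff image_is_empty)
  have "Poly_Mapping.lookup (Poly_Mapping.single 0 c * substituted k) m = (if k = m then c else 0)"
    if k: "k \<in> Poly_Mapping.keys p" for k c
  proof -
    have "m \<notin> Poly_Mapping.keys (substituted k - Poly_Mapping.single k 1)"
      using leads_substituted[of k] m(2)[OF k] by (auto simp: leads_def)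
    then have "Poly_Mapping.lookup (substituted k) m = (if k = m then 1 else 0)"
      by (simp add: in_keys_iff lookup_minus lookup_single when_def)
    then show ?thesis
      by (subst lookup_single_mult) simp
  qed
  then have "Poly_Mapping.lookup (substitution p) m = Poly_Mapping.lookup p m"
    using m(1) by (simp add: substitution_def lookup_sum)
  then show False using m(1) assms by (simp add: in_keys_iff)
qed

lemma inj_substitution: "substitution p = substitution q \<Longrightarrow> p = q"
  using substitution_add[of "p - q" q] substitution_eq_0[of "p - q"] by simp

lemma substitution_surj_sum:
  assumes "\<And>m. m \<in> Poly_Mapping.keys p \<Longrightarrow>
    \<exists>q\<in>carrier (poly_ring V). substitution q = Poly_Mapping.single m (Poly_Mapping.lookup p m)"
  shows "\<exists>q\<in>carrier (poly_ring V). substitution q = p"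
proof -
  obtain q where q: "\<And>m. m \<in> Poly_Mapping.keys p \<Longrightarrow> q m \<in> carrier (poly_ring V)"
    "\<And>m. m \<in> Poly_Mapping.keys p \<Longrightarrow> substitution (q m) = Poly_Mapping.single m (Poly_Mapping.lookup p m)"
    using assms by metis
  have "substitution (\<Sum>m\<in>Poly_Mapping.keys p. q m) = p"
    unfolding substitution_sum by (subst (3) poly_mapping_eq_sum_single) (simp add: q(2))
  then show ?thesis using sum_in_poly_ring[of "Poly_Mapping.keys p" q V] q(1) by blast
qed

text \<open>The image of the term itself is off by monomials of smaller weight, and these are images
  by induction.\<close>

lemma substitution_surj_single:
  assumes "m \<in> monomials V"
  shows "\<exists>q\<in>carrier (poly_ring V). substitution q = Poly_Mapping.single m c"
  using assms
proof (induction m arbitrary: c rule: measure_induct_rule[of W])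
  case (less m)
  define r where "r = Poly_Mapping.single 0 (- c) * (substituted m - Poly_Mapping.single m 1)"
  have r: "k \<in> monomials V \<and> W k < W m" if "k \<in> Poly_Mapping.keys r" for k
  proof -
    have k: "k \<in> Poly_Mapping.keys (substituted m - Poly_Mapping.single m 1)"
      using that unfolding r_def in_keys_iff by (subst (asm) lookup_single_mult) auto
    then show ?thesis
      using leads_substituted[of m] keys_diff_subset[of "substituted m" "Poly_Mapping.single m 1"] less.prems
        substituted_in_poly_ring[OF less.prems]
      by (auto simp: leads_def)
  qed
  have "\<exists>q\<in>carrier (poly_ring V). substitution q = r"
    by (rule substitution_surj_sum) (use r less.IH in blast)
  then obtain q where q: "q \<in> carrier (poly_ring V)" "substitution q = r" by blast
  have "substitution (q + Poly_Mapping.single m c) = Poly_Mapping.single m c"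
    by (simp add: substitution_add substitution_single q r_def single_uminus algebra_simps mult_single)
  then show ?case
    using add_in_poly_ring[OF q(1) single_in_poly_ring[OF less.prems]] by blast
qed

lemma substitution_surj:
  assumes "p \<in> carrier (poly_ring V)"
  shows "\<exists>q\<in>carrier (poly_ring V). substitution q = p"
proof (rule substitution_surj_sum)
  fix m assume "m \<in> Poly_Mapping.keys p"
  then show "\<exists>q\<in>carrier (poly_ring V). substitution q = Poly_Mapping.single m (Poly_Mapping.lookup p m)"
    using assms by (intro substitution_surj_single) auto
qed

text \<open>The ideal generated by the first \<open>k\<close> monomials \<open>u j\<close>,
  described through divisibility so that membership can be tested term by term.\<close>

definition monomial_ideal :: "nat \<Rightarrow> ('v, 'k) mpoly set" where
  "monomial_ideal k = {p \<in> carrier (poly_ring V).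
     \<forall>m\<in>Poly_Mapping.keys p. \<exists>j<k. \<forall>v. Poly_Mapping.lookup (u j) v \<le> Poly_Mapping.lookup m v}"

lemma monomial_ideal_add: "p \<in> monomial_ideal k \<Longrightarrow> q \<in> monomial_ideal k \<Longrightarrow> p + q \<in> monomial_ideal k"
  using Poly_Mapping.keys_add[of p q] unfolding monomial_ideal_def
  by (intro CollectI conjI ballI add_in_poly_ring) (simp_all, blast)

lemma u_mult_in_monomial_ideal:
  assumes "j < k" "k \<le> n" "p \<in> carrier (poly_ring V)"
  shows "Poly_Mapping.single (u j) 1 * p \<in> monomial_ideal k"
proof -
  have "Poly_Mapping.single (u j) 1 * p \<in> carrier (poly_ring V)"
    using assms u_monomial[of j] by (intro mult_in_poly_ring single_in_poly_ring) auto
  moreover have "\<exists>j<k. \<forall>v. Poly_Mapping.lookup (u j) v \<le> Poly_Mapping.lookup m v"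
    if "m \<in> Poly_Mapping.keys (Poly_Mapping.single (u j) 1 * p)" for m
    using keys_mult[of "Poly_Mapping.single (u j) 1" p] that assms(1)
    by (fastforce simp: lookup_add)
  ultimately show ?thesis by (auto simp: monomial_ideal_def)
qed

lemma monomial_ideal_term:
  assumes "k \<le> n" "p \<in> monomial_ideal k" "m \<in> Poly_Mapping.keys p"
  obtains j m' where "j < k" "m' \<in> monomials V" "substituted m = f j * substituted m'"
proof -
  obtain j where j: "j < k" "\<And>v. Poly_Mapping.lookup (u j) v \<le> Poly_Mapping.lookup m v"
    using assms by (auto simp: monomial_ideal_def)
  have m: "m = (m - u j) + u j" by (rule pointwise_le_imp_add) (rule j(2))
  have "m \<in> monomials V" using assms by (auto simp: monomial_ideal_def)
  then have "m - u j \<in> monomials V" using m add_in_monomials_iff by metis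
  then show ?thesis using that[OF j(1)] substituted_add[of j "m - u j"] m j(1) assms(1) by simp
qed

text \<open>The substitution is not multiplicative, so its image is not obviously an ideal. But each
  monomial in \<open>monomial_ideal k\<close> has some factor \<open>u j\<close>, hence an image
  divisible by \<open>f j\<close>; and every multiple of \<open>f j\<close> is an image because the
  substitution is surjective.\<close>

lemma Idl_eq_substitution_image:
  assumes k: "k \<le> n"
  shows "Idl\<^bsub>poly_ring V\<^esub> (f ` {..<k}) = substitution ` monomial_ideal k"
proof -
  interpret cring "poly_ring V :: ('v, 'k) mpoly ring" by (rule cring_poly_ring)
  have fc: "f ` {..<k} \<subseteq> carrier (poly_ring V)" using f_carrier k by (auto simp del: poly_ring_simps(1))
  interpret J: poly_ideal V "Idl\<^bsub>poly_ring V\<^esub> (f ` {..<k})"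
    by (rule poly_ideal.intro[OF genideal_ideal[OF fc]])
  have fJ: "f j \<in> Idl\<^bsub>poly_ring V\<^esub> (f ` {..<k})" if "j < k" for j
    using genideal_self[OF fc] that by auto
  have zero: "0 \<in> substitution ` monomial_ideal k"
    using substitution_zero by (force simp: monomial_ideal_def)
  have add: "x + y \<in> substitution ` monomial_ideal k"
    if "x \<in> substitution ` monomial_ideal k" "y \<in> substitution ` monomial_ideal k" for x y
    using that monomial_ideal_add by (force simp flip: substitution_add)
  have sum: "sum g A \<in> substitution ` monomial_ideal k"
    if "\<And>i. i \<in> A \<Longrightarrow> g i \<in> substitution ` monomial_ideal k" for g and A :: "'v monomial set"
    using that by (induction A rule: infinite_finite_induct) (auto intro: add zero)
  have f_mult: "f j * g \<in> substitution ` monomial_ideal k" if j: "j < k" and g: "g \<in> carrier (poly_ring V)" for j g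
  proof -
    obtain q where "q \<in> carrier (poly_ring V)" "substitution q = g"
      using substitution_surj[OF g] by blast
    then show ?thesis
      using u_mult_in_monomial_ideal[OF j k] substitution_mult_u[of j q] j k
      by (metis image_eqI order_less_le_trans)
  qed
  have "ideal (substitution ` monomial_ideal k) (poly_ring V)"
  proof (rule poly_idealI)
    show "substitution ` monomial_ideal k \<subseteq> carrier (poly_ring V)"
      using substitution_in_poly_ring by (auto simp: monomial_ideal_def simp del: poly_ring_simps(1))
    fix r x :: "('v, 'k) mpoly" assume r: "r \<in> carrier (poly_ring V)" and "x \<in> substitution ` monomial_ideal k"
    then obtain p where p: "p \<in> monomial_ideal k" "x = substitution p" by blast
    have x: "r * x = (\<Sum>m\<in>Poly_Mapping.keys p.
        r * (Poly_Mapping.single 0 (Poly_Mapping.lookup p m) * substituted m))"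
      unfolding p(2) substitution_def by (rule sum_distrib_left)
    show "r * x \<in> substitution ` monomial_ideal k"
      unfolding x
    proof (rule sum)
      fix m assume "m \<in> Poly_Mapping.keys p"
      from monomial_ideal_term[OF k p(1) this] obtain j m' where
        j: "j < k" "m' \<in> monomials V" "substituted m = f j * substituted m'" .
      have "r * (Poly_Mapping.single 0 (Poly_Mapping.lookup p m) * substituted m)
        = f j * (r * (Poly_Mapping.single 0 (Poly_Mapping.lookup p m) * substituted m'))"
        by (simp add: j(3) mult_ac)
      then show "r * (Poly_Mapping.single 0 (Poly_Mapping.lookup p m) * substituted m)
        \<in> substitution ` monomial_ideal k"
        using f_mult[OF j(1) mult_in_poly_ring[OF r mult_in_poly_ring[OF single_in_poly_ring[OF zero_in_monomials]
          substituted_in_poly_ring[OF j(2)]]]] by simp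
    qed
  qed (use zero add in auto)
  moreover have "f ` {..<k} \<subseteq> substitution ` monomial_ideal k"
    using f_mult[of _ 1] by (auto simp: zero_in_monomials)
  ultimately have "Idl\<^bsub>poly_ring V\<^esub> (f ` {..<k}) \<subseteq> substitution ` monomial_ideal k"
    by (rule genideal_minimal)
  moreover have "substitution p \<in> Idl\<^bsub>poly_ring V\<^esub> (f ` {..<k})" if p: "p \<in> monomial_ideal k" for p
    unfolding substitution_def
  proof (rule J.sum)
    fix m assume "m \<in> Poly_Mapping.keys p"
    from monomial_ideal_term[OF k p this] obtain j m' where
      j: "j < k" "m' \<in> monomials V" "substituted m = f j * substituted m'" .
    have "Poly_Mapping.single 0 (Poly_Mapping.lookup p m) * substituted m
      = (Poly_Mapping.single 0 (Poly_Mapping.lookup p m) * substituted m') * f j"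
      by (simp add: j(3) mult_ac)
    then show "Poly_Mapping.single 0 (Poly_Mapping.lookup p m) * substituted m \<in> Idl\<^bsub>poly_ring V\<^esub> (f ` {..<k})"
      using J.mult[OF fJ[OF j(1)] mult_in_poly_ring[OF single_in_poly_ring[OF zero_in_monomials]
          substituted_in_poly_ring[OF j(2)]]] by simp
  qed
  ultimately show ?thesis by blast
qed

text \<open>If \<open>u j\<close> divides the product of \<open>u i\<close> and a monomial, it
  divides the monomial, as it has no variable in common with \<open>u i\<close>.\<close>

lemma monomial_ideal_cancel:
  assumes "i < n" "p \<in> carrier (poly_ring V)" "Poly_Mapping.single (u i) 1 * p \<in> monomial_ideal i"
  shows "p \<in> monomial_ideal i"
proof -
  have "\<exists>j<i. \<forall>v. Poly_Mapping.lookup (u j) v \<le> Poly_Mapping.lookup m v" if m: "m \<in> Poly_Mapping.keys p" for m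
  proof -
    have "Poly_Mapping.lookup (Poly_Mapping.single (u i) 1 * p) (u i + m) = Poly_Mapping.lookup p m"
    proof -
      have "Poly_Mapping.single (u i) 1 * p = (\<Sum>k\<in>Poly_Mapping.keys p. Poly_Mapping.single (u i + k) (Poly_Mapping.lookup p k))"
        by (subst (1) poly_mapping_eq_sum_single[of p]) (simp add: sum_distrib_left mult_single)
      then show ?thesis using m by (simp add: lookup_sum lookup_single when_def)
    qed
    then have "u i + m \<in> Poly_Mapping.keys (Poly_Mapping.single (u i) 1 * p)"
      using m by (simp add: in_keys_iff)
    then obtain j where j: "j < i" "\<And>v. Poly_Mapping.lookup (u j) v \<le> Poly_Mapping.lookup (u i + m) v"
      using assms(3) by (auto simp: monomial_ideal_def)
    have "Poly_Mapping.lookup (u j) v \<le> Poly_Mapping.lookup m v" for v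
    proof (cases "v \<in> Poly_Mapping.keys (u j)")
      case True
      then have "Poly_Mapping.lookup (u i) v = 0"
        using u_disjoint[of i j] j(1) assms(1) by (auto simp: in_keys_iff)
      then show ?thesis using j(2)[of v] by (simp add: lookup_add)
    qed (simp add: in_keys_iff)
    then show ?thesis using j(1) by blast
  qed
  then show ?thesis using assms(2) by (simp add: monomial_ideal_def)
qed

text \<open>A relation for \<open>f i\<close> modulo the earlier polynomials is pulled back to one
  for \<open>u i\<close> modulo the earlier monomials, where \<open>u i\<close> cancels.\<close>

lemma regular_sequence_leading_system: "regular_sequence (poly_ring V) (map f [0..<n])"
  unfolding regular_sequence_def
proof (intro conjI allI impI ballI)
  show "set (map f [0..<n]) \<subseteq> carrier (poly_ring V)"
    using f_carrier by (auto simp del: poly_ring_simps(1))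
next
  fix i g assume i: "i < length (map f [0..<n])" and g: "g \<in> carrier (poly_ring V)"
    and "map f [0..<n] ! i \<otimes>\<^bsub>poly_ring V\<^esub> g \<in> Idl\<^bsub>poly_ring V\<^esub> (set (take i (map f [0..<n])))"
  moreover have set_take: "set (take i (map f [0..<n])) = f ` {..<i}"
    using i by (auto simp: take_map min_def)
  ultimately have fg: "f i * g \<in> substitution ` monomial_ideal i"
    using Idl_eq_substitution_image[of i] by simp
  obtain q where q: "q \<in> carrier (poly_ring V)" "substitution q = g"
    using substitution_surj[OF g] by blast
  have "substitution (Poly_Mapping.single (u i) 1 * q) \<in> substitution ` monomial_ideal i"
    using fg substitution_mult_u[of i q] i q by simp
  then have "Poly_Mapping.single (u i) 1 * q \<in> monomial_ideal i"
    using inj_substitution by blast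
  then have "q \<in> monomial_ideal i" using monomial_ideal_cancel[OF _ q(1)] i by simp
  then show "g \<in> Idl\<^bsub>poly_ring V\<^esub> (set (take i (map f [0..<n])))"
    unfolding set_take using Idl_eq_substitution_image[of i] i q(2) by auto
next
  have set_all: "set (map f [0..<n]) = f ` {..<n}" by auto
  show "Idl\<^bsub>poly_ring V\<^esub> (set (map f [0..<n])) \<noteq> carrier (poly_ring V)"
  proof
    assume "Idl\<^bsub>poly_ring V\<^esub> (set (map f [0..<n])) = carrier (poly_ring V)"
    \<comment> \<open>The substitution fixes 1, so properness reduces to the fact that no
      \<open>u j\<close> divides the monomial 1.\<close>
    then have "1 \<in> substitution ` monomial_ideal n"
      using Idl_eq_substitution_image[of n] unfolding set_all by (auto simp: zero_in_monomials)
    moreover have "exponent i 0 = 0" if "i < n" for i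
      using u_nonzero[OF that] by (simp add: exponent_def)
    then have "substituted 0 = 1" by (simp add: substituted_def leading_part_def)
    then have "1 = substitution 1"
      using substitution_single[of 0 1] by simp
    ultimately have "1 \<in> monomial_ideal n" using inj_substitution by (metis imageE)
    then obtain j where "j < n" "\<And>v. Poly_Mapping.lookup (u j) v = 0" by (auto simp: monomial_ideal_def)
    then show False using u_nonzero[of j] by (metis lookup_zero poly_mapping_eqI)
  qed
qed

end

section \<open>A toric prime containing the polyomino ideal\<close>

definition monomial_weight :: "('v \<Rightarrow> 't \<Rightarrow>\<^sub>0 int) \<Rightarrow> 'v monomial \<Rightarrow> 't \<Rightarrow>\<^sub>0 int" where
  "monomial_weight w m = (\<Sum>v\<in>Poly_Mapping.keys m. frag_cmul (int (Poly_Mapping.lookup m v)) (w v))"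

lemma monomial_weight_add: "monomial_weight w (m + n) = monomial_weight w m + monomial_weight w n"
  unfolding monomial_weight_def
  by (rule setsum_keys_plus_distrib) (simp_all add: frag_cmul_distrib)

lemma monomial_weight_zero [simp]: "monomial_weight w 0 = 0"
  by (simp add: monomial_weight_def)

lemma monomial_weight_single [simp]: "monomial_weight w (Poly_Mapping.single v (Suc 0)) = w v"
  by (simp add: monomial_weight_def)

text \<open>The homomorphism that sends the variable \<open>v\<close> to the Laurent monomial with
  exponent \<open>w v\<close>. Laurent polynomials appear as the group algebra of the free abelian
  group of finitely supported integer functions.\<close>

definition toric_map ::
  "('v \<Rightarrow> 't \<Rightarrow>\<^sub>0 int) \<Rightarrow> ('v, 'k::field) mpoly \<Rightarrow> ('t \<Rightarrow>\<^sub>0 int) \<Rightarrow>\<^sub>0 'k" where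
  "toric_map w p = (\<Sum>m\<in>Poly_Mapping.keys p. Poly_Mapping.single (monomial_weight w m) (Poly_Mapping.lookup p m))"

lemma toric_map_add: "toric_map w (p + q) = toric_map w p + toric_map w q"
  unfolding toric_map_def by (rule setsum_keys_plus_distrib) (simp_all add: single_add)

lemma toric_map_zero: "toric_map w 0 = 0"
  by (simp add: toric_map_def)

lemma toric_map_diff: "toric_map w (p - q) = toric_map w p - toric_map w q"
  using toric_map_add[of w "p - q" q] by simp

lemma toric_map_sum: "toric_map w (sum p A) = (\<Sum>i\<in>A. toric_map w (p i))"
  by (induction A rule: infinite_finite_induct) (simp_all add: toric_map_add toric_map_zero)

lemma toric_map_single: "toric_map w (Poly_Mapping.single m c) = Poly_Mapping.single (monomial_weight w m) c"
  by (simp add: toric_map_def)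

lemma toric_map_mult: "toric_map w (p * q) = toric_map w p * toric_map w q"
proof -
  have "p * q = (\<Sum>m\<in>Poly_Mapping.keys p. \<Sum>n\<in>Poly_Mapping.keys q.
      Poly_Mapping.single (m + n) (Poly_Mapping.lookup p m * Poly_Mapping.lookup q n))"
    by (subst (1) poly_mapping_eq_sum_single[of p], subst (1) poly_mapping_eq_sum_single[of q])
      (simp add: sum_product mult_single)
  then have "toric_map w (p * q) = (\<Sum>m\<in>Poly_Mapping.keys p. \<Sum>n\<in>Poly_Mapping.keys q.
      Poly_Mapping.single (monomial_weight w m + monomial_weight w n)
        (Poly_Mapping.lookup p m * Poly_Mapping.lookup q n))"
    by (simp only: toric_map_sum toric_map_single monomial_weight_add)
  also have "\<dots> = toric_map w p * toric_map w q"
    by (simp add: toric_map_def sum_product mult_single)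
  finally show ?thesis .
qed

lemma toric_map_var: "toric_map w (var v) = Poly_Mapping.single (w v) 1"
  by (simp add: var_def toric_map_single)

definition toric_ideal :: "'v set \<Rightarrow> ('v \<Rightarrow> 't \<Rightarrow>\<^sub>0 int) \<Rightarrow> ('v, 'k::field) mpoly set" where
  "toric_ideal V w = {p \<in> carrier (poly_ring V). toric_map w p = 0}"

text \<open>A kernel into a domain is prime. The linear order on \<open>'t\<close> orders the
  exponent group linearly, so the largest terms of two nonzero Laurent polynomials multiply without
  cancellation.\<close>

lemma primeideal_toric_ideal:
  fixes w :: "'v \<Rightarrow> 't::linorder \<Rightarrow>\<^sub>0 int"
  shows "primeideal (toric_ideal V w :: ('v, 'k::field) mpoly set) (poly_ring V)"
proof (rule primeidealI)
  show "ideal (toric_ideal V w :: ('v, 'k) mpoly set) (poly_ring V)"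
    by (rule poly_idealI)
      (auto simp: toric_ideal_def toric_map_add toric_map_mult toric_map_zero
        simp del: poly_ring_simps(1) intro: add_in_poly_ring mult_in_poly_ring,
        simp)
  have "toric_map w 1 = (1 :: ('t \<Rightarrow>\<^sub>0 int) \<Rightarrow>\<^sub>0 'k)"
    using toric_map_single[of w 0 1] by simp
  then have "1 \<notin> (toric_ideal V w :: ('v, 'k) mpoly set)"
    by (simp add: toric_ideal_def)
  moreover have "1 \<in> carrier (poly_ring V :: ('v, 'k) mpoly ring)"
    by (simp add: zero_in_monomials)
  ultimately show "carrier (poly_ring V) \<noteq> (toric_ideal V w :: ('v, 'k) mpoly set)" by blast
qed (auto simp: cring_poly_ring toric_ideal_def toric_map_mult)

text \<open>On monomials in \<open>T\<close> the weight is the exponent vector itself, so different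
  monomials of \<open>g\<close> have different images.\<close>

lemma toric_ideal_independent:
  fixes w :: "'v \<Rightarrow> 'v \<Rightarrow>\<^sub>0 int"
  assumes w: "\<And>t. t \<in> T \<Longrightarrow> w t = frag_of t"
    and g: "Poly_Mapping.keys g \<subseteq> monomials T" "g \<in> toric_ideal V w"
  shows "g = 0"
proof (rule poly_mapping_eqI)
  fix m
  have weight: "Poly_Mapping.lookup (monomial_weight w k) t = int (Poly_Mapping.lookup k t)"
    if "k \<in> monomials T" for k t
  proof -
    have "monomial_weight w k = (\<Sum>v\<in>Poly_Mapping.keys k. frag_cmul (int (Poly_Mapping.lookup k v)) (frag_of v))"
      unfolding monomial_weight_def using that w by (intro sum.cong) (auto simp: monomials_def)
    then show ?thesis by (simp add: lookup_sum in_keys_iff if_distrib[of "(*) _"] cong: if_cong)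
  qed
  have inj: "monomial_weight w k = monomial_weight w m \<longleftrightarrow> k = m"
    if "k \<in> monomials T" "m \<in> monomials T" for k m
    using weight[OF that(1)] weight[OF that(2)] by (metis of_nat_eq_iff poly_mapping_eqI)
  show "Poly_Mapping.lookup g m = Poly_Mapping.lookup 0 m"
  proof (cases "m \<in> Poly_Mapping.keys g")
    case True
    have "Poly_Mapping.lookup (toric_map w g) (monomial_weight w m)
      = (\<Sum>k\<in>Poly_Mapping.keys g. if k = m then Poly_Mapping.lookup g k else 0)"
      unfolding toric_map_def lookup_sum lookup_single when_def
      using inj g(1) True by (intro sum.cong) auto
    also have "\<dots> = Poly_Mapping.lookup g m" using True by simp
    finally show ?thesis using g(2) by (simp add: toric_ideal_def)
  qed (simp add: in_keys_iff)
qed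

section \<open>Vertex weights satisfying one relation for each cell\<close>

lemma cell_inject [simp]: "cell a = cell b \<longleftrightarrow> a = b"
proof
  assume eq: "cell a = cell b"
  have self: "c \<in> cell c" for c by (auto simp: cell_def grid_interval_def)
  have "a \<in> cell b" "b \<in> cell a" using self[of a] self[of b] by (simp_all add: eq)
  then show "a = b" by (auto simp: cell_def grid_interval_def prod_eq_iff)
qed simp

text \<open>In lexicographic order, the upper right corner of the last cell belongs to no other
  cell, so its weight can be chosen freely.\<close>

lemma cell_weight_exists:
  assumes "finite A"
  shows "\<exists>w :: point \<Rightarrow> point \<Rightarrow>\<^sub>0 int.
    (\<forall>(i, j)\<in>A. w (i, j) + w (i + 1, j + 1) = w (i, j + 1) + w (i + 1, j)) \<and>
    (\<forall>t. t \<notin> (\<lambda>(i, j). (i + 1, j + 1)) ` A \<longrightarrow> w t = frag_of t)"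
  using assms
proof (induction A rule: finite_linorder_max_induct)
  case empty
  show ?case by auto
next
  case (insert b A)
  then obtain w :: "point \<Rightarrow> point \<Rightarrow>\<^sub>0 int" where w:
    "\<forall>(i, j)\<in>A. w (i, j) + w (i + 1, j + 1) = w (i, j + 1) + w (i + 1, j)"
    "\<forall>t. t \<notin> (\<lambda>(i, j). (i + 1, j + 1)) ` A \<longrightarrow> w t = frag_of t" by blast
  obtain k l where b: "b = (k, l)" by (cases b)
  define w' where "w' = w((k + 1, l + 1) := w (k, l + 1) + w (k + 1, l) - w (k, l))"
  have "w' (i, j) + w' (i + 1, j + 1) = w' (i, j + 1) + w' (i + 1, j)" if "(i, j) \<in> A" for i j
  proof -
    have "i < k \<or> i = k \<and> j < l" using insert.hyps(2) that b by force
    then show ?thesis using w(1) that by (auto simp: w'_def)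
  qed
  moreover have "w' (k, l) + w' (k + 1, l + 1) = w' (k, l + 1) + w' (k + 1, l)"
    by (simp add: w'_def)
  moreover have "w' t = frag_of t" if "t \<notin> (\<lambda>(i, j). (i + 1, j + 1)) ` insert b A" for t
  proof -
    have "t \<noteq> (k + 1, l + 1)" "t \<notin> (\<lambda>(i, j). (i + 1, j + 1)) ` A" using that by (auto simp: b)
    then show ?thesis using spec[OF w(2), of t] by (simp add: w'_def)
  qed
  ultimately show ?case using b by (intro exI[of _ w']) auto
qed

text \<open>Gluing of two rectangles: \<open>a\<close> and \<open>c\<close> are the values at the
  ends of the common side and cancel.\<close>

lemma rectangle_relation_trans:
  fixes a b c d e f :: "'w::ab_group_add"
  assumes "a + b = c + d" "e + c = f + a"
  shows "e + b = f + d"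
proof -
  have "(e + b) + (a + c) = (a + b) + (e + c)" by (simp add: ac_simps)
  also have "\<dots> = (f + d) + (a + c)" unfolding assms by (simp add: ac_simps)
  finally show ?thesis by (rule add_right_imp_eq)
qed

text \<open>The relation survives gluing: cells are joined to horizontal strips, and the strips are
  stacked.\<close>

lemma inner_interval_weight:
  fixes w :: "point \<Rightarrow> 'w::ab_group_add"
  assumes w: "\<And>i j. cell (i, j) \<in> P \<Longrightarrow> w (i, j) + w (i + 1, j + 1) = w (i, j + 1) + w (i + 1, j)"
    and inner: "inner_interval P (i, j) (k, l)"
  shows "w (i, j) + w (k, l) = w (i, l) + w (k, j)"
proof -
  have lt: "i < k" "j < l" using inner by (auto simp: inner_interval_def proper_interval_def)
  have P: "cell (p, q) \<in> P" if "i \<le> p" "p < k" "j \<le> q" "q < l" for p q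
  proof -
    have "cell (p, q) \<subseteq> grid_interval (i, j) (k, l)"
      using that by (auto simp: cell_eq_corners grid_interval_def)
    then show ?thesis using inner by (auto simp: inner_interval_def)
  qed
  have row: "w (i, q) + w (p, q + 1) = w (i, q + 1) + w (p, q)"
    if "i \<le> p" "p \<le> k" "j \<le> q" "q < l" for p q
    using that(1,2)
  proof (induction p rule: int_ge_induct)
    case base
    then show ?case by (simp add: add.commute)
  next
    case (step p)
    have "w (p, q) + w (p + 1, q + 1) = w (p, q + 1) + w (p + 1, q)"
      using w P step that by auto
    moreover have "w (i, q) + w (p, q + 1) = w (i, q + 1) + w (p, q)" using step by simp
    ultimately show ?case by (rule rectangle_relation_trans)
  qed
  have "w (i, j) + w (k, q) = w (i, q) + w (k, j)" if "j \<le> q" "q \<le> l" for q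
    using that
  proof (induction q rule: int_ge_induct)
    case base
    then show ?case by simp
  next
    case (step q)
    have "w (i, q) + w (k, q + 1) = w (k, q) + w (i, q + 1)"
      using row[of k q] step lt by (simp add: add.commute)
    moreover have "w (i, j) + w (k, q) = w (k, j) + w (i, q)"
      using step by (simp add: add.commute)
    ultimately have "w (i, j) + w (k, q + 1) = w (k, j) + w (i, q + 1)"
      by (rule rectangle_relation_trans)
    then show ?case by (simp add: add.commute)
  qed
  from this[of l] show ?thesis using lt by simp
qed

lemma ideal_height_polyomino_ideal_le:
  assumes "finite P" "P \<subseteq> range cell"
  shows "ideal_height (poly_ring (vertices P)) (polyomino_ideal P :: (point, 'k::field) mpoly set) \<le> enat (card P)"
proof -
  interpret cring "poly_ring (vertices P) :: (point, 'k) mpoly ring" by (rule cring_poly_ring)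
  define A where "A = {a. cell a \<in> P}"
  have P: "P = cell ` A" using assms(2) by (auto simp: A_def)
  have inj: "inj_on cell B" for B by (simp add: inj_on_def)
  have finA: "finite A" using assms(1) finite_image_iff[OF inj[of A]] P by simp
  obtain w :: "point \<Rightarrow> point \<Rightarrow>\<^sub>0 int" where w:
    "\<And>i j. (i, j) \<in> A \<Longrightarrow> w (i, j) + w (i + 1, j + 1) = w (i, j + 1) + w (i + 1, j)"
    "\<And>t. t \<notin> (\<lambda>(i, j). (i + 1, j + 1)) ` A \<Longrightarrow> w t = frag_of t"
    using cell_weight_exists[OF finA] by blast
  define U where "U = (\<lambda>(i, j). (i + 1, j + 1) :: point) ` A"
  define T where "T = vertices P - U"
  have finV: "finite (vertices P)"
    using finA by (auto simp: vertices_def P cell_eq_corners)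
  have UV: "U \<subseteq> vertices P" by (auto simp: U_def vertices_def P cell_eq_corners)
  \<comment> \<open>A cell is determined by its upper right corner.\<close>
  have "card U = card P"
    unfolding U_def P using inj by (subst (1 2) card_image) (auto simp: inj_on_def)
  then have card: "card (vertices P) - card T = card P"
    using card_Diff_subset[OF finite_subset[OF UV finV] UV] card_mono[OF finV UV] by (simp add: T_def)
  let ?p = "toric_ideal (vertices P) w :: (point, 'k) mpoly set"
  have prime: "primeideal ?p (poly_ring (vertices P))" by (rule primeideal_toric_ideal)
  have "polyomino_ideal P \<subseteq> ?p"
    unfolding polyomino_ideal_def
  proof (rule genideal_minimal[OF primeideal.axioms(1)[OF prime]], rule subsetI)
    fix f :: "(point, 'k) mpoly" assume f: "f \<in> inner_minors P"
    then obtain i j k l where ij: "inner_interval P (i, j) (k, l)"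
      "f = var (i, j) * var (k, l) - var (i, l) * var (k, j)"
      by (auto simp: inner_minors_def)
    have "w (i, j) + w (k, l) = w (i, l) + w (k, j)"
      by (rule inner_interval_weight[OF _ ij(1)]) (simp add: w A_def)
    then have "toric_map w f = 0"
      by (simp add: ij(2) toric_map_diff toric_map_mult toric_map_var mult_single)
    then show "f \<in> ?p" using f inner_minors_in_poly_ring unfolding toric_ideal_def by blast
  qed
  then have "ideal_height (poly_ring (vertices P)) (polyomino_ideal P :: (point, 'k) mpoly set)
    \<le> prime_height (poly_ring (vertices P)) ?p"
    unfolding ideal_height_def using prime by (intro Inf_lower) blast
  also have "\<dots> \<le> enat (card (vertices P) - card T)"
  proof (rule prime_height_le[OF finV])
    show "g = 0" if "Poly_Mapping.keys g \<subseteq> monomials T" "g \<in> ?p" for g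
      using toric_ideal_independent[of T w g "vertices P"] w(2) that by (simp add: T_def U_def)
  qed (simp add: T_def)
  finally show ?thesis by (simp add: card)
qed

section \<open>Inner minors\<close>

definition quadric :: "'v \<Rightarrow> 'v \<Rightarrow> 'v monomial" where
  "quadric a b = Poly_Mapping.single a 1 + Poly_Mapping.single b 1"

lemma keys_quadric [simp]: "Poly_Mapping.keys (quadric a b) = {a, b}"
  by (auto simp: quadric_def in_keys_iff lookup_add lookup_single when_def split: if_splits)

lemma quadric_commute: "quadric a b = quadric b a"
  by (simp add: quadric_def add.commute)

lemma var_mult_var: "var a * var b = Poly_Mapping.single (quadric a b) 1"
  by (simp add: var_def quadric_def mult_single)

lemma inner_minor_eq:
  "var a * var b - var c * var d
    = (Poly_Mapping.single (quadric a b) 1 - Poly_Mapping.single (quadric c d) 1 :: ('v, 'k::field) mpoly)"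
  by (simp add: var_mult_var)

lemma keys_binomial:
  "m \<noteq> n \<Longrightarrow> Poly_Mapping.keys (Poly_Mapping.single m 1 - Poly_Mapping.single n (1 :: 'k::field)) = {m, n}"
  by (auto simp: in_keys_iff lookup_minus lookup_single when_def split: if_splits)

lemma monomial_degree_add: "monomial_degree (m + n) = monomial_degree m + monomial_degree n"
  unfolding monomial_degree_def by (rule setsum_keys_plus_distrib) simp_all

lemma monomial_degree_quadric: "monomial_degree (quadric a b) = 2"
  unfolding quadric_def monomial_degree_add by (simp add: monomial_degree_def)

lemma monomial_degree_eq_0: "monomial_degree m = 0 \<Longrightarrow> m = 0"
  by (auto simp: monomial_degree_def in_keys_iff intro!: poly_mapping_eqI)

text \<open>The variables of a quadric give back the pair of corners. Diagonal corners are
  comparable in the componentwise order and anti-diagonal ones are not, so the two kinds of pairs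
  cannot be confused.\<close>

lemma diagonal_quadric_eq:
  assumes "i < k" "j < l" "i' < k'" "j' < (l' :: int)"
  shows "quadric (i :: int, j :: int) (k, l) = quadric (i', j') (k', l') \<Longrightarrow> i = i' \<and> j = j' \<and> k = k' \<and> l = l'"
    and "quadric (i, j) (k, l) \<noteq> quadric (i', l') (k', j')"
proof -
  show "i = i' \<and> j = j' \<and> k = k' \<and> l = l'" if "quadric (i, j) (k, l) = quadric (i', j') (k', l')"
    using arg_cong[OF that, of Poly_Mapping.keys] assms by (auto simp: doubleton_eq_iff)
  show "quadric (i, j) (k, l) \<noteq> quadric (i', l') (k', j')"
  proof
    assume eq: "quadric (i, j) (k, l) = quadric (i', l') (k', j')"
    show False
      using arg_cong[OF eq, of Poly_Mapping.keys] assms by (auto simp: doubleton_eq_iff)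
  qed
qed

lemma inner_minors_cases:
  assumes "f \<in> inner_minors P"
  obtains i j k l where "i < k" "j < l" "inner_interval P (i, j) (k, l)"
    "f = Poly_Mapping.single (quadric (i, j) (k, l)) 1 - Poly_Mapping.single (quadric (i, l) (k, j)) 1"
    "Poly_Mapping.keys f = {quadric (i, j) (k, l), quadric (i, l) (k, j)}"
proof -
  obtain i j k l where ij: "inner_interval P (i, j) (k, l)"
    "f = var (i, j) * var (k, l) - var (i, l) * var (k, j)"
    using assms by (auto simp: inner_minors_def)
  have "i < k" "j < l" using ij(1) by (auto simp: inner_interval_def proper_interval_def)
  then show ?thesis
    using that[OF _ _ ij(1)] ij(2) keys_binomial[OF diagonal_quadric_eq(2), of i k j l i k j l]
    unfolding inner_minor_eq by simp
qed

lemma finite_inner_minors: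
  assumes "finite P" "P \<subseteq> range cell"
  shows "finite (inner_minors P)"
proof -
  have "finite C" if "C \<in> P" for C using assms(2) that by (auto simp: cell_eq_corners)
  then have "finite (vertices P)" using assms(1) by (simp add: vertices_def)
  moreover have "inner_minors P \<subseteq> (\<lambda>(a, b). var a * var b - var (fst a, snd b) * var (fst b, snd a))
      ` (vertices P \<times> vertices P)"
  proof
    fix f assume "f \<in> inner_minors P"
    then obtain a b where ab: "inner_interval P a b"
      "f = var a * var b - var (fst a, snd b) * var (fst b, snd a)"
      unfolding inner_minors_def by blast
    show "f \<in> (\<lambda>(a, b). var a * var b - var (fst a, snd b) * var (fst b, snd a)) ` (vertices P \<times> vertices P)"
      by (rule image_eqI[of _ _ "(a, b)"]) (use ab inner_interval_corners[OF ab(1)] in simp_all)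
  qed
  ultimately show ?thesis using finite_subset by blast
qed

text \<open>Distinct inner minors have no monomial in common, and all have degree two.\<close>

lemma minimal_homogeneous_generators_inner_minors:
  assumes "finite P" "P \<subseteq> range cell"
  shows "minimal_homogeneous_generators (vertices P)
    (polyomino_ideal P :: (point, 'k::field) mpoly set) (inner_minors P)"
  unfolding minimal_homogeneous_generators_def
proof (intro conjI allI impI ballI)
  interpret cring "poly_ring (vertices P) :: (point, 'k) mpoly ring" by (rule cring_poly_ring)
  show "inner_minors P \<subseteq> carrier (poly_ring (vertices P) :: (point, 'k) mpoly ring)"
    by (rule inner_minors_in_poly_ring)
  show "finite (inner_minors P :: (point, 'k) mpoly set)" by (rule finite_inner_minors[OF assms])
  show "Idl\<^bsub>poly_ring (vertices P)\<^esub> (inner_minors P) = (polyomino_ideal P :: (point, 'k) mpoly set)"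
    by (simp add: polyomino_ideal_def)
  show "homogeneous f" if "f \<in> inner_minors P" for f :: "(point, 'k) mpoly"
    using that by (rule inner_minors_cases) (auto simp: homogeneous_def monomial_degree_quadric)
  fix G :: "(point, 'k) mpoly set"
  assume "G \<subset> inner_minors P"
  then obtain g where g: "g \<in> inner_minors P" "g \<notin> G" and G: "G \<subseteq> inner_minors P" by blast
  from g(1) obtain i j k l where ij: "i < k" "j < l"
    and g_eq: "g = Poly_Mapping.single (quadric (i, j) (k, l)) 1 - Poly_Mapping.single (quadric (i, l) (k, j)) 1"
    "Poly_Mapping.keys g = {quadric (i, j) (k, l), quadric (i, l) (k, j)}"
    by (rule inner_minors_cases)
  \<comment> \<open>An ideal that separates \<open>g\<close> from the other minors. It is closed
    under multiplication by degree: a multiple of a monomial of degree at least two can only be the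
    excluded quadric if the cofactor is 1.\<close>
  define Z :: "(point, 'k) mpoly set" where
    "Z = {p \<in> carrier (poly_ring (vertices P)).
      \<forall>m\<in>Poly_Mapping.keys p. 2 \<le> monomial_degree m \<and> m \<noteq> quadric (i, j) (k, l)}"
  have "ideal Z (poly_ring (vertices P))"
  proof (rule poly_idealI)
    show "x + y \<in> Z" if "x \<in> Z" "y \<in> Z" for x y
      using Poly_Mapping.keys_add[of x y] that by (auto simp: Z_def)
    fix r x :: "(point, 'k) mpoly" assume r: "r \<in> carrier (poly_ring (vertices P))" and x: "x \<in> Z"
    have "2 \<le> monomial_degree m \<and> m \<noteq> quadric (i, j) (k, l)" if m: "m \<in> Poly_Mapping.keys (r * x)" for m
    proof -
      obtain a b where ab: "m = a + b" "b \<in> Poly_Mapping.keys x" using keys_mult[of r x] m by blast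
      have b: "2 \<le> monomial_degree b" "b \<noteq> quadric (i, j) (k, l)" using x ab(2) by (auto simp: Z_def)
      have "m \<noteq> quadric (i, j) (k, l)"
      proof
        assume m: "m = quadric (i, j) (k, l)"
        have "monomial_degree (a + b) = 2"
          unfolding ab(1)[symmetric] m by (rule monomial_degree_quadric)
        then have "monomial_degree a + monomial_degree b = 2" by (simp add: monomial_degree_add)
        then have "a = 0" using b(1) by (intro monomial_degree_eq_0) simp
        then show False using b(2) m ab(1) by simp
      qed
      then show ?thesis using b(1) by (simp add: ab(1) monomial_degree_add)
    qed
    then show "r * x \<in> Z" using mult_in_poly_ring[OF r, of x] x by (simp add: Z_def)
  qed (auto simp: Z_def)
  moreover have "G \<subseteq> Z"
  proof
    fix h assume h: "h \<in> G"
    then have "h \<in> inner_minors P" using G by blast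
    then obtain i' j' k' l' where ij': "i' < k'" "j' < l'"
      and h_eq: "h = Poly_Mapping.single (quadric (i', j') (k', l')) 1
        - Poly_Mapping.single (quadric (i', l') (k', j')) 1"
      "Poly_Mapping.keys h = {quadric (i', j') (k', l'), quadric (i', l') (k', j')}"
      by (rule inner_minors_cases)
    have "h \<noteq> g" using g(2) h by blast
    then have "quadric (i', j') (k', l') \<noteq> quadric (i, j) (k, l)"
      using diagonal_quadric_eq(1)[OF ij' ij] unfolding g_eq(1) h_eq(1) by auto
    moreover have "quadric (i', l') (k', j') \<noteq> quadric (i, j) (k, l)"
      using diagonal_quadric_eq(2)[OF ij ij'] by metis
    moreover have "h \<in> carrier (poly_ring (vertices P))"
      using \<open>h \<in> inner_minors P\<close> inner_minors_in_poly_ring by blast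
    ultimately show "h \<in> Z" unfolding Z_def h_eq(2) by (auto simp: monomial_degree_quadric h_eq(2))
  qed
  ultimately have "Idl\<^bsub>poly_ring (vertices P)\<^esub> G \<subseteq> Z" by (rule genideal_minimal)
  moreover have "g \<notin> Z" by (simp add: Z_def g_eq(2))
  moreover have "g \<in> polyomino_ideal P"
    using genideal_self[OF inner_minors_in_poly_ring] g(1) unfolding polyomino_ideal_def by blast
  ultimately show "Idl\<^bsub>poly_ring (vertices P)\<^esub> G \<noteq> polyomino_ideal P" by blast
qed

section \<open>Weight orders\<close>

definition weight_degree :: "('v \<Rightarrow> nat) \<Rightarrow> 'v monomial \<Rightarrow> nat" where
  "weight_degree \<omega> m = (\<Sum>v\<in>Poly_Mapping.keys m. Poly_Mapping.lookup m v * \<omega> v)"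

lemma weight_degree_add: "weight_degree \<omega> (m + n) = weight_degree \<omega> m + weight_degree \<omega> n"
  unfolding weight_degree_def by (rule setsum_keys_plus_distrib) (simp_all add: distrib_right)

lemma weight_degree_quadric: "weight_degree \<omega> (quadric a b) = \<omega> a + \<omega> b"
  unfolding quadric_def weight_degree_add by (simp add: weight_degree_def)

text \<open>Weights alone do not distinguish all monomials; ties are broken lexicographically, at
  the smallest variable where the exponents differ.\<close>

definition weight_order :: "'v::linorder set \<Rightarrow> ('v \<Rightarrow> nat) \<Rightarrow> 'v monomial rel" where
  "weight_order V \<omega> = {(m, n). m \<in> monomials V \<and> n \<in> monomials V \<and>
     (weight_degree \<omega> m < weight_degree \<omega> n \<or> weight_degree \<omega> m = weight_degree \<omega> n \<and> m \<le> n)}"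

lemma monomial_nonneg: "0 \<le> (m :: 'v::linorder monomial)"
proof (cases "m = 0")
  case False
  then have ne: "Poly_Mapping.keys m \<noteq> {}" by simp
  define k where "k = Min (Poly_Mapping.keys m)"
  have "k \<in> Poly_Mapping.keys m" using ne by (simp add: k_def)
  moreover have "Poly_Mapping.lookup m k' = 0" if "k' < k" for k'
  proof (rule ccontr)
    assume "Poly_Mapping.lookup m k' \<noteq> 0"
    then have "k \<le> k'" unfolding k_def by (intro Min_le) (simp_all add: in_keys_iff)
    then show False using that by simp
  qed
  ultimately have "0 < m"
    by (auto simp: less_poly_mapping.rep_eq less_fun_def in_keys_iff)
  then show ?thesis by simp
qed simp

lemma monomial_order_weight_order: "monomial_order V (weight_order V \<omega>)"
  unfolding monomial_order_def
proof (intro conjI ballI allI impI)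
  show "linear_order_on (monomials V) (weight_order V \<omega>)"
    unfolding linear_order_on_def partial_order_on_def preorder_on_def weight_order_def
    by (auto simp: refl_on_def trans_def antisym_def total_on_def)
  show "(0, m) \<in> weight_order V \<omega>" if "m \<in> monomials V" for m
  proof -
    have "weight_degree \<omega> 0 = 0" by (simp add: weight_degree_def)
    then show ?thesis
      using that monomial_nonneg[of m] by (simp add: weight_order_def zero_in_monomials) linarith
  qed
  show "(m + l, n + l) \<in> weight_order V \<omega>" if "l \<in> monomials V" "(m, n) \<in> weight_order V \<omega>" for m n l
    using that by (auto simp: weight_order_def add_in_monomials weight_degree_add intro: add_right_mono)
qed

lemma initial_monomial_weight_order:
  assumes "Poly_Mapping.keys f = {m, n}" "m \<in> monomials V" "n \<in> monomials V"
    and "weight_degree \<omega> n < weight_degree \<omega> m"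
  shows "initial_monomial (weight_order V \<omega>) f = Poly_Mapping.single m 1"
proof -
  have "(THE k. k \<in> Poly_Mapping.keys f \<and> (\<forall>l\<in>Poly_Mapping.keys f. (l, k) \<in> weight_order V \<omega>)) = m"
    by (rule the_equality) (use assms in \<open>auto simp: weight_order_def\<close>)
  then show ?thesis by (simp add: initial_monomial_def)
qed

section \<open>Closed paths\<close>

text \<open>Symmetric in the two diagonals and in the ends of each, so that no case depends on the
  orientation of the path; the price is that the minor is determined only up to sign.\<close>

definition opposite_corners :: "point set set \<Rightarrow> point \<Rightarrow> point \<Rightarrow> point \<Rightarrow> point \<Rightarrow> bool" where
  "opposite_corners P p q r s \<longleftrightarrow> (\<exists>a b. inner_interval P a b \<and>
     ({p, q} = {a, b} \<and> {r, s} = {(fst a, snd b), (fst b, snd a)} \<or>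
      {r, s} = {a, b} \<and> {p, q} = {(fst a, snd b), (fst b, snd a)}))"

lemma mem_cell: "(p, q) \<in> cell (x, y) \<longleftrightarrow> x \<le> p \<and> p \<le> x + 1 \<and> y \<le> q \<and> q \<le> y + 1"
  by (auto simp: cell_def grid_interval_def)

lemma opposite_corners_commute:
  "opposite_corners P p q r s \<longleftrightarrow> opposite_corners P q p r s"
  "opposite_corners P p q r s \<longleftrightarrow> opposite_corners P p q s r"
  "opposite_corners P p q r s \<longleftrightarrow> opposite_corners P r s p q"
  unfolding opposite_corners_def by (simp_all add: insert_commute disj_commute)

lemma inner_intervalI:
  assumes "i < k" "j < l"
    and "\<And>p q. i \<le> p \<Longrightarrow> p < k \<Longrightarrow> j \<le> q \<Longrightarrow> q < l \<Longrightarrow> cell (p, q) \<in> P"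
  shows "inner_interval P (i, j) (k, l)"
  unfolding inner_interval_def
proof (intro conjI ballI impI)
  show "proper_interval (i, j) (k, l)" using assms by (simp add: proper_interval_def)
  fix C assume "C \<in> range cell" and sub: "C \<subseteq> grid_interval (i, j) (k, l)"
  then obtain p q where C: "C = cell (p, q)" by auto
  have "(p, q) \<in> C" "(p + 1, q + 1) \<in> C" by (auto simp: C cell_eq_corners)
  then have "(p, q) \<in> grid_interval (i, j) (k, l)" "(p + 1, q + 1) \<in> grid_interval (i, j) (k, l)"
    using sub by blast+
  then show "C \<in> P" unfolding C by (intro assms(3)) (auto simp: grid_interval_def)
qed

lemma opposite_cornersI:
  assumes "x < x'" "y < y'"
    and "\<And>p q. x \<le> p \<Longrightarrow> p < x' \<Longrightarrow> y \<le> q \<Longrightarrow> q < y' \<Longrightarrow> cell (p, q) \<in> P"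
  shows "opposite_corners P (x, y) (x', y') (x, y') (x', y)"
  unfolding opposite_corners_def using inner_intervalI[OF assms]
  by (intro exI[of _ "(x, y)"] exI[of _ "(x', y')"]) simp

lemma opposite_corners_cell:
  assumes "cell (x, y) \<in> P"
  shows "opposite_corners P (x, y) (x + 1, y + 1) (x, y + 1) (x + 1, y)"
proof (rule opposite_cornersI)
  fix p q assume "x \<le> p" "p < x + 1" "y \<le> q" "q < y + 1"
  then have "p = x" "q = y" by auto
  then show "cell (p, q) \<in> P" using assms by simp
qed auto

lemma opposite_corners_horizontal:
  assumes "cell (x, y) \<in> P" "cell (x + 1, y) \<in> P"
  shows "opposite_corners P (x, y) (x + 2, y + 1) (x, y + 1) (x + 2, y)"
proof (rule opposite_cornersI)
  fix p q assume "x \<le> p" "p < x + 2" "y \<le> q" "q < y + 1"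
  then have "p = x \<or> p = x + 1" "q = y" by auto
  then show "cell (p, q) \<in> P" using assms by auto
qed auto

lemma opposite_corners_vertical:
  assumes "cell (x, y) \<in> P" "cell (x, y + 1) \<in> P"
  shows "opposite_corners P (x, y) (x + 1, y + 2) (x, y + 2) (x + 1, y)"
proof (rule opposite_cornersI)
  fix p q assume "x \<le> p" "p < x + 1" "y \<le> q" "q < y + 2"
  then have "p = x" "q = y \<or> q = y + 1" by auto
  then show "cell (p, q) \<in> P" using assms by auto
qed auto

definition unit_vectors :: "point set" where
  "unit_vectors = {(1, 0), (-1, 0), (0, 1), (0, -1)}"

definition opp :: "point \<Rightarrow> point" where "opp v = (- fst v, - snd v)"

definition perpendicular :: "point \<Rightarrow> point \<Rightarrow> bool" where
  "perpendicular v w \<longleftrightarrow> fst v * fst w + snd v * snd w = 0"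

text \<open>The corner of \<open>cell a\<close> in the diagonal direction \<open>v + w\<close>, for perpendicular unit vectors
  \<open>v\<close> and \<open>w\<close>.\<close>

definition corner :: "point \<Rightarrow> point \<Rightarrow> point \<Rightarrow> point" where
  "corner a v w = (fst a + (1 + fst v + fst w) div 2, snd a + (1 + snd v + snd w) div 2)"

text \<open>Indices run over all integers with period \<open>n\<close>, so predecessors need no
  wrap-around. The residues \<open>n - 1\<close> and \<open>n - 2\<close> in \<open>near\<close>
  stand for one and two steps back.\<close>

locale cyclic_path =
  fixes P :: "point set set" and n :: int and a :: "int \<Rightarrow> point" and d :: "int \<Rightarrow> point"
  assumes n: "5 < n"
    and periodic: "a (i mod n) = a i"
    and inj: "a i = a j \<Longrightarrow> i mod n = j mod n"
    and cell_in: "cell (a i) \<in> P"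
    and step: "a (i + 1) = (fst (a i) + fst (d i), snd (a i) + snd (d i))"
    and unit: "d i \<in> unit_vectors"
    and near: "cell (a i) \<inter> cell (a j) \<noteq> {} \<Longrightarrow> (j - i) mod n \<in> {0, 1, 2, n - 1, n - 2}"
begin

lemma a_cong: "i mod n = j mod n \<Longrightarrow> a i = a j"
  using periodic[of i] periodic[of j] by simp

lemma d_cong:
  assumes "i mod n = j mod n"
  shows "d i = d j"
proof -
  have "(i + 1) mod n = (j + 1) mod n" using assms by (metis mod_add_left_eq)
  then have "a i = a j" "a (i + 1) = a (j + 1)" using assms a_cong by blast+
  then show ?thesis using step[of i] step[of j] by (simp add: prod_eq_iff)
qed

lemma not_cong_small:
  assumes "i mod n = j mod n" "\<bar>i - j\<bar> < n"
  shows "i = j"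
proof -
  have "n dvd i - j" using assms(1) by (simp add: mod_eq_dvd_iff)
  then show ?thesis using assms(2) zdvd_not_zless[of "\<bar>i - j\<bar>" n] by auto
qed

text \<open>A reversal would return to the same cell after two steps.\<close>

lemma no_reversal: "d (i + 1) \<noteq> opp (d i)"
proof
  assume eq: "d (i + 1) = opp (d i)"
  have "a (i + 2) = a i"
    using step[of i] step[of "i + 1"] eq by (simp add: prod_eq_iff opp_def add.assoc)
  from inj[OF this] show False using not_cong_small[of "i + 2" i] n by simp
qed

lemma perpendicular_turn:
  assumes "d i \<noteq> d (i + 1)"
  shows "perpendicular (d i) (d (i + 1))"
  using assms no_reversal[of i] unit[of i] unit[of "i + 1"]
  by (auto simp: unit_vectors_def perpendicular_def opp_def)

text \<open>Two consecutive turns in the same direction would close up a two by two square.\<close>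

lemma no_double_turn:
  assumes "d i \<noteq> d (i + 1)"
  shows "d (i + 2) \<noteq> opp (d i)"
proof
  assume eq: "d (i + 2) = opp (d i)"
  have "a (i + 3) = (fst (a i) + fst (d (i + 1)), snd (a i) + snd (d (i + 1)))"
    using step[of i] step[of "i + 1"] step[of "i + 2"] eq by (simp add: prod_eq_iff opp_def add.assoc)
  \<comment> \<open>A common corner of two adjacent cells: the componentwise maximum of their lower
    left corners.\<close>
  moreover have "(max x (x + p), max y (y + q)) \<in> cell (x, y) \<inter> cell (x + p, y + q)"
    if "(p, q) \<in> unit_vectors" for x y p q
    using that by (auto simp: unit_vectors_def mem_cell)
  from this[of "fst (d (i + 1))" "snd (d (i + 1))" "fst (a i)" "snd (a i)"]
  have "(max (fst (a i)) (fst (a i) + fst (d (i + 1))), max (snd (a i)) (snd (a i) + snd (d (i + 1))))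
    \<in> cell (a i) \<inter> cell (fst (a i) + fst (d (i + 1)), snd (a i) + snd (d (i + 1)))"
    using unit[of "i + 1"] by simp
  ultimately have "cell (a i) \<inter> cell (a (i + 3)) \<noteq> {}" by auto
  from near[OF this] have "3 \<in> {0, 1, 2, n - 1, n - 2}" using n by simp
  then show False using n by auto
qed

text \<open>Without turns, one round would be a translation by \<open>n\<close> times a unit vector
  and could not close up.\<close>

lemma turn_exists: "\<exists>j. d (j - 1) \<noteq> d j"
proof (rule ccontr)
  assume "\<nexists>j. d (j - 1) \<noteq> d j"
  then have same: "d (j - 1) = d j" for j by blast
  have const: "d (int k) = d 0" for k
  proof (induction k)
    case (Suc k)
    then show ?case using same[of "int (Suc k)"] by simp
  qed simp
  have "a (int k) = (fst (a 0) + int k * fst (d 0), snd (a 0) + int k * snd (d 0))" for k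
  proof (induction k)
    case (Suc k)
    then show ?case using step[of "int k"] const[of k] by (simp add: algebra_simps)
  qed simp
  from this[of "nat n"] have "a n = (fst (a 0) + n * fst (d 0), snd (a 0) + n * snd (d 0))"
    using n by simp
  moreover have "a n = a 0" by (rule a_cong) simp
  ultimately show False using unit[of 0] n by (auto simp: unit_vectors_def prod_eq_iff)
qed

definition before_turn :: "int \<Rightarrow> nat" where
  "before_turn i = (LEAST k. d (i - 1 - int k) \<noteq> d (i - 1))"

text \<open>The direction of travel before the last turn.\<close>

definition side :: "int \<Rightarrow> point" where
  "side i = d (i - 1 - int (before_turn i))"

lemma before_turn_exists: "\<exists>k. d (i - 1 - int k) \<noteq> d (i - 1)"
proof -
  obtain j where j: "d (j - 1) \<noteq> d j" using turn_exists by blast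
  \<comment> \<open>The known turn is moved back by \<open>K\<close> periods to lie before
    \<open>i\<close>. One of the two steps at the turn must differ from step
    \<open>i - 1\<close>.\<close>
  define K where "K = \<bar>j\<bar> + \<bar>i\<bar> + 1"
  define J where "J = j - n * K"
  have "1 * K \<le> n * K" unfolding K_def using n by (intro mult_right_mono) auto
  moreover have "j - K \<le> i - 1" unfolding K_def by arith
  ultimately have J: "J \<le> i - 1" unfolding J_def by linarith
  have "d J = d j" "d (J - 1) = d (j - 1)"
    by (rule d_cong, simp add: J_def mod_eq_dvd_iff)+
  then have "d J \<noteq> d (i - 1) \<or> d (J - 1) \<noteq> d (i - 1)" using j by metis
  moreover have "J = i - 1 - int (nat (i - 1 - J))" "J - 1 = i - 1 - int (nat (i - J))" using J by auto
  ultimately show ?thesis by metis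
qed

lemma side_cong:
  assumes "i mod n = j mod n"
  shows "side i = side j"
proof -
  have "d (i - x) = d (j - x)" for x
    by (rule d_cong) (metis assms mod_diff_left_eq)
  then have "d (i - 1 - x) = d (j - 1 - x)" for x by (metis diff_diff_eq)
  from this this[of 0] show ?thesis by (simp add: side_def before_turn_def)
qed

lemma side_straight:
  assumes "d (i - 2) = d (i - 1)"
  shows "side i = side (i - 1)"
proof -
  obtain k where "d (i - 1 - int k) \<noteq> d (i - 1)" using before_turn_exists by blast
  then have "before_turn i = Suc (LEAST k. d (i - 1 - int (Suc k)) \<noteq> d (i - 1))"
    unfolding before_turn_def by (rule Least_Suc) simp
  also have "(LEAST k. d (i - 1 - int (Suc k)) \<noteq> d (i - 1)) = before_turn (i - 1)"
  proof -
    have shift: "i - 1 - int (Suc k) = i - 1 - 1 - int k" for k by simp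
    have "d (i - 1 - 1) = d (i - 1)" using assms by simp
    then show ?thesis unfolding before_turn_def shift by simp
  qed
  finally show ?thesis by (simp add: side_def algebra_simps)
qed

lemma side_turn:
  assumes "d (i - 2) \<noteq> d (i - 1)"
  shows "side i = d (i - 2)"
proof -
  have "before_turn i = 1"
    unfolding before_turn_def
  proof (rule Least_equality)
    show "d (i - 1 - int 1) \<noteq> d (i - 1)" using assms by simp
    show "1 \<le> k" if "d (i - 1 - int k) \<noteq> d (i - 1)" for k using that by (cases k) auto
  qed
  then show ?thesis by (simp add: side_def)
qed

lemma side_unit: "side i \<in> unit_vectors"
  unfolding side_def by (rule unit)

text \<open>The search backwards stops at the first change of direction, so the next step already
  has direction \<open>d (i - 1)\<close>; consecutive different directions are
  perpendicular.\<close>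

lemma side_perpendicular: "perpendicular (side i) (d (i - 1))"
proof -
  define k where "k = before_turn i"
  have k: "d (i - 1 - int k) \<noteq> d (i - 1)"
    unfolding k_def before_turn_def using before_turn_exists by (rule LeastI_ex)
  then have "0 < k" by (cases k) auto
  then have "\<not> d (i - 1 - int (k - 1)) \<noteq> d (i - 1)"
    unfolding k_def before_turn_def by (intro not_less_Least) simp
  then have k1: "d (i - 1 - int k + 1) = d (i - 1)"
    using \<open>0 < k\<close> by (simp add: of_nat_diff algebra_simps)
  then show ?thesis
    using perpendicular_turn[of "i - 1 - int k"] k unfolding side_def k_def[symmetric] by simp
qed

text \<open>The far edge of the \<open>i\<close>th cell consists of \<open>carried i\<close> and \<open>matched i\<close>. The latter is
  paired with \<open>carried (i - 1)\<close>; the opposite pair of corners is \<open>carried i\<close> and \<open>spare i\<close>.\<close>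

definition carried :: "int \<Rightarrow> point" where
  "carried i = corner (a i) (d (i - 1)) (side i)"

definition matched :: "int \<Rightarrow> point" where
  "matched i = corner (a i) (d (i - 1)) (opp (side i))"

definition spare :: "int \<Rightarrow> point" where
  "spare i = (fst (carried (i - 1)) - fst (side i), snd (carried (i - 1)) - snd (side i))"

lemma carried_cong:
  assumes eq: "i mod n = j mod n"
  shows "carried i = carried j"
proof -
  have "(i - 1) mod n = (j - 1) mod n" using eq by (metis mod_diff_left_eq)
  then show ?thesis
    using a_cong[OF eq] d_cong[of "i - 1" "j - 1"] side_cong[OF eq] by (simp add: carried_def)
qed

section \<open>The new vertices of each cell and their pairing\<close>

lemma far_edge:
  "carried i \<in> cell (a i) - cell (a (i - 1))" "matched i \<in> cell (a i) - cell (a (i - 1))"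
  "carried i \<noteq> matched i"
proof -
  obtain x y where a: "a (i - 1) = (x, y)" by (cases "a (i - 1)")
  have "a i = (x + fst (d (i - 1)), y + snd (d (i - 1)))" using step[of "i - 1"] by (simp add: a)
  then show "carried i \<in> cell (a i) - cell (a (i - 1))" "matched i \<in> cell (a i) - cell (a (i - 1))"
    "carried i \<noteq> matched i"
    using unit[of "i - 1"] side_unit[of i] side_perpendicular[of i]
    by (auto simp: a carried_def matched_def corner_def unit_vectors_def perpendicular_def opp_def mem_cell)
qed

text \<open>One step on, the previous cell is \<open>a i\<close>, which contains \<open>v\<close>.
  Two steps on, the cells at both ends of the two steps meet, if at all, in a corner that also
  belongs to the cell between them.\<close>

lemma far_edge_unique_aux:
  assumes "v \<in> cell (a i) - cell (a (i - 1))" "v \<in> cell (a j) - cell (a (j - 1))"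
  shows "(j - i) mod n \<noteq> 1" "(j - i) mod n \<noteq> 2"
proof -
  have cong: "j mod n = (i + k) mod n" "(j - 1) mod n = (i + k - 1) mod n"
    if "(j - i) mod n = k" for k
  proof -
    have "n dvd (j - i) - k" using that by (metis dvd_minus_mod)
    then show "j mod n = (i + k) mod n" "(j - 1) mod n = (i + k - 1) mod n"
      by (simp_all add: mod_eq_dvd_iff algebra_simps)
  qed
  show "(j - i) mod n \<noteq> 1"
  proof
    assume "(j - i) mod n = 1"
    from cong(2)[OF this] have "a (j - 1) = a i" by (intro a_cong) simp
    then show False using assms by simp
  qed
  show "(j - i) mod n \<noteq> 2"
  proof
    assume "(j - i) mod n = 2"
    note cong = cong[OF this]
    have "(j - 1) mod n = (i + 1) mod n" using cong(2) by (simp add: add.commute)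
    then have "a j = a (i + 2)" "a (j - 1) = a (i + 1)" using cong(1) a_cong by blast+
    then have v: "v \<in> cell (a i)" "v \<in> cell (a (i + 2))" "v \<notin> cell (a (i + 1))" using assms by auto
    obtain x y where a: "a i = (x, y)" by (cases "a i")
    obtain p q where d: "d i = (p, q)" by (cases "d i")
    obtain p' q' where d': "d (i + 1) = (p', q')" by (cases "d (i + 1)")
    have a1: "a (i + 1) = (x + p, y + q)" using step[of i] by (simp add: a d)
    have a2: "a (i + 2) = (x + p + p', y + q + q')" using step[of "i + 1"] by (simp add: a1 d' add.assoc)
    show False
      using v unit[of i] unit[of "i + 1"] no_reversal[of i] unfolding a a1 a2 d d'
      by (cases v) (auto simp: unit_vectors_def opp_def mem_cell)
  qed
qed

text \<open>By \<open>near\<close> only cyclic distances up to two remain; exchanging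
  \<open>i\<close> and \<open>j\<close> treats steps backwards like steps forwards.\<close>

lemma far_edge_unique:
  assumes "v \<in> cell (a i) - cell (a (i - 1))" "v \<in> cell (a j) - cell (a (j - 1))"
  shows "i mod n = j mod n"
proof -
  have "(j - i) mod n \<in> {0, 1, 2, n - 1, n - 2}" using assms near[of i j] by blast
  moreover have "(j - i) mod n \<noteq> 1" "(j - i) mod n \<noteq> 2"
    using far_edge_unique_aux[OF assms] by auto
  moreover have "(j - i) mod n \<noteq> n - k" if "k \<in> {1, 2}" for k
  proof
    assume "(j - i) mod n = n - k"
    then have "n dvd (j - i) - (n - k)" by (metis dvd_minus_mod)
    then have "n dvd (i - j) - k"
      by (metis (no_types, opaque_lifting) add_diff_cancel_left' diff_add_cancel diff_diff_eq2 dvd_diff_commute dvd_add_triv_right_iff diff_diff_add)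
    then have "(i - j) mod n = k mod n" by (simp add: mod_eq_dvd_iff)
    also have "\<dots> = k" using that n by auto
    finally show False using far_edge_unique_aux[OF assms(2,1)] that by auto
  qed
  ultimately have "(j - i) mod n = 0" by auto
  then show ?thesis by (metis mod_eq_dvd_iff mod_0_imp_dvd)
qed

lemma carried_inject: "carried i = carried j \<Longrightarrow> i mod n = j mod n"
  using far_edge_unique far_edge(1) by metis

lemma matched_inject: "matched i = matched j \<Longrightarrow> i mod n = j mod n"
  using far_edge_unique far_edge(2) by metis

lemma carried_neq_matched: "carried i \<noteq> matched j"
  using far_edge_unique[of "carried i" i j] far_edge carried_cong[of i j] by metis

text \<open>On a straight stretch, or at a turn towards \<open>side (i - 1)\<close>, the vertex
  \<open>carried (i - 1)\<close> lies on the edge shared with the \<open>i\<close>th cell, and that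
  cell is the interval. At a turn away from \<open>side (i - 1)\<close> it lies on the opposite edge
  of the previous cell, and the interval consists of both cells.\<close>

lemma opposite_corners_matched:
  "opposite_corners P (carried (i - 1)) (matched i) (carried i) (spare i)"
proof -
  obtain x y where a: "a (i - 1) = (x, y)" by (cases "a (i - 1)")
  obtain p q where d: "d (i - 1) = (p, q)" by (cases "d (i - 1)")
  obtain s t where side: "side (i - 1) = (s, t)" by (cases "side (i - 1)")
  obtain p' q' where d': "d (i - 2) = (p', q')" by (cases "d (i - 2)")
  have ai: "a i = (x + p, y + q)" using step[of "i - 1"] by (simp add: a d)
  have cells: "cell (x, y) \<in> P" "cell (x + p, y + q) \<in> P"
    using cell_in[of "i - 1"] cell_in[of i] by (simp_all add: a ai)
  note corners = opposite_corners_cell[OF cells(1)] opposite_corners_cell[OF cells(2)]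
  have units: "(p, q) \<in> unit_vectors" "(p', q') \<in> unit_vectors" "(s, t) \<in> unit_vectors"
    using unit[of "i - 1"] unit[of "i - 2"] side_unit[of "i - 1"] by (simp_all add: d d' side)
  have perp: "perpendicular (s, t) (p', q')"
    using side_perpendicular[of "i - 1"] by (simp add: side d')
  show ?thesis
  proof (cases "(p, q) = (p', q')")
    case True
    then have "side i = (s, t)" using side_straight[of i] d d' side by simp
    then show ?thesis
      using units perp True opposite_corners_cell[OF cells(2)]
      unfolding carried_def matched_def spare_def corner_def opp_def ai a d d' side
      by (auto simp: unit_vectors_def perpendicular_def d d' opposite_corners_commute)
  next
    case False
    then have turn: "d (i - 2) \<noteq> d (i - 1)" by (auto simp: d d')
    from side_turn[OF turn] have side_i: "side i = (p', q')" by (simp add: d')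
    have perp': "perpendicular (p', q') (p, q)"
      using perpendicular_turn[of "i - 2"] turn by (simp add: d d')
    have right: "opposite_corners P (x, y) (x + 2, y + 1) (x, y + 1) (x + 2, y)" if "(p, q) = (1, 0)"
      using opposite_corners_horizontal[of x y P] cells that by simp
    have left: "opposite_corners P (x - 1, y) (x + 1, y + 1) (x - 1, y + 1) (x + 1, y)" if "(p, q) = (-1, 0)"
      using opposite_corners_horizontal[of "x - 1" y P] cells that by (simp add: add.commute)
    have up: "opposite_corners P (x, y) (x + 1, y + 2) (x, y + 2) (x + 1, y)" if "(p, q) = (0, 1)"
      using opposite_corners_vertical[of x y P] cells that by simp
    have down: "opposite_corners P (x, y - 1) (x + 1, y + 1) (x, y + 1) (x + 1, y - 1)" if "(p, q) = (0, -1)"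
      using opposite_corners_vertical[of x "y - 1" P] cells that by (simp add: add.commute)
    show ?thesis
      using units perp perp' opposite_corners_cell[OF cells(2)] right left up down
      unfolding carried_def matched_def spare_def corner_def opp_def ai a d side side_i
      by (auto simp: unit_vectors_def perpendicular_def d' opposite_corners_commute add_ac)
  qed
qed

text \<open>Supplies the place of the cut. At a turn, \<open>spare i\<close> lies on the edge
  between cells \<open>i - 2\<close> and \<open>i - 1\<close>, at its end towards
  \<open>side (i - 1)\<close>. It can fail to be \<open>carried (i - 2)\<close> only if there was a
  turn just before, with \<open>side (i - 2)\<close> pointing backwards along
  \<open>d (i - 2)\<close>. Then that earlier turn serves instead: a third turn in a row would make
  a forbidden double turn.\<close>

lemma spare_is_carried: "\<exists>i. spare i = carried (i - 2)"
proof -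
  have *: "spare i = carried (i - 2)"
    if turn: "d (i - 2) \<noteq> d (i - 1)" and side: "d (i - 3) = d (i - 2) \<or> side (i - 2) \<noteq> opp (d (i - 2))" for i
  proof -
    have s: "side i = d (i - 2)" by (rule side_turn[OF turn])
    have "corner (a (i - 2)) (d (i - 2)) (side (i - 1)) = carried (i - 2)"
    proof (cases "d (i - 3) = d (i - 2)")
      case True
      then show ?thesis using side_straight[of "i - 1"] by (simp add: carried_def)
    next
      case False
      have "side (i - 2) \<noteq> opp (d (i - 2))" using False side by simp
      moreover have "perpendicular (d (i - 3)) (d (i - 2))"
        using perpendicular_turn[of "i - 3"] False by simp
      ultimately have "side (i - 2) = d (i - 2)"
        using side_perpendicular[of "i - 2"] side_unit[of "i - 2"] unit[of "i - 2"] unit[of "i - 3"]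
        by (auto simp: unit_vectors_def perpendicular_def opp_def)
      then show ?thesis using side_turn[of "i - 1"] False
        by (simp add: carried_def corner_def add_ac)
    qed
    moreover have "a (i - 1) = (fst (a (i - 2)) + fst (d (i - 2)), snd (a (i - 2)) + snd (d (i - 2)))"
      using step[of "i - 2"] by simp
    ultimately show ?thesis
      by (simp add: spare_def carried_def[of "i - 1"] corner_def s prod_eq_iff)
  qed
  obtain j where j: "d (j - 1) \<noteq> d j" using turn_exists by blast
  show ?thesis
  proof (cases "d (j - 2) = d (j - 1) \<or> side (j - 1) \<noteq> opp (d (j - 1))")
    case True
    then have "spare (j + 1) = carried (j + 1 - 2)" using *[of "j + 1"] j by auto
    then show ?thesis by blast
  next
    case False
    then have turn: "d (j - 2) \<noteq> d (j - 1)" and side: "side (j - 1) = opp (d (j - 1))" by auto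
    have "d (j - 3) = d (j - 2)"
    proof (rule ccontr)
      assume ne: "d (j - 3) \<noteq> d (j - 2)"
      then have "d (j - 3) = opp (d (j - 1))" using side_turn[of "j - 1"] side by simp
      then have "d (j - 1) = opp (d (j - 3))" by (simp add: opp_def prod_eq_iff)
      then show False using no_double_turn[of "j - 3"] ne by simp
    qed
    then show ?thesis using *[of j] turn by blast
  qed
qed

end

section \<open>From closed paths to cyclic paths and inner minors\<close>

lemma shared_edge_step:
  assumes edge: "edge_of (cell (x, y) \<inter> cell (x', y')) (cell (x, y))" and neq: "(x, y) \<noteq> (x', y')"
  shows "(x' - x, y' - y) \<in> unit_vectors"
proof -
  let ?E = "cell (x, y) \<inter> cell (x', y')"
  have "?E \<in> {{(x, y), (x + 1, y)}, {(x, y + 1), (x + 1, y + 1)},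
      {(x, y), (x, y + 1)}, {(x + 1, y), (x + 1, y + 1)}}"
    using edge unfolding edge_of_def by auto
  then consider "(x, y) \<in> ?E" "(x + 1, y) \<in> ?E" | "(x, y + 1) \<in> ?E" "(x + 1, y + 1) \<in> ?E"
    | "(x, y) \<in> ?E" "(x, y + 1) \<in> ?E" | "(x + 1, y) \<in> ?E" "(x + 1, y + 1) \<in> ?E"
    by (elim insertE) (simp_all only: insertI1 insert_iff, blast+)
  then show ?thesis
    using neq by cases (auto simp: mem_cell unit_vectors_def)
qed

lemma closed_path_cyclic:
  assumes "closed_path P"
  shows "\<exists>a d. cyclic_path P (int (card P)) a d"
proof -
  from assms[unfolded closed_path_def, THEN conjunct2]
  obtain A n where n: "length A = n" "n > 5" and A: "set A = P" "distinct A"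
    and edges: "\<forall>i<n. edge_of (A ! i \<inter> A ! ((i + 1) mod n)) (A ! i) \<and>
               edge_of (A ! i \<inter> A ! ((i + 1) mod n)) (A ! ((i + 1) mod n))"
    and far: "\<forall>i<n. \<forall>j<n.
           j \<notin> {(i + n - 2) mod n, (i + n - 1) mod n, i, (i + 1) mod n, (i + 2) mod n} \<longrightarrow>
           vertices {A ! i} \<inter> vertices {A ! j} = {}"
    by (elim exE conjE) (rule that)
  have cells: "P \<subseteq> range cell" using assms by (simp add: closed_path_def polyomino_def)
  have card: "card P = n" using A n distinct_card by metis
  define idx where "idx i = nat (i mod int n)" for i
  have idx: "idx i < n" "int (idx i) = i mod int n" for i
    using n by (simp_all add: idx_def nat_less_iff)
  define a where "a i = inv_into UNIV cell (A ! idx i)" for i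
  have cell_a: "cell (a i) = A ! idx i" for i
    unfolding a_def using cells A n idx(1) by (intro f_inv_into_f) (metis nth_mem subsetD)
  define d where "d i = (fst (a (i + 1)) - fst (a i), snd (a (i + 1)) - snd (a i))" for i
  have idx_cong: "idx i = idx j \<longleftrightarrow> i mod int n = j mod int n" for i j
    using idx(2) by (metis of_nat_eq_iff)
  have a_inject: "a i = a j \<Longrightarrow> i mod int n = j mod int n" for i j
    using cell_a nth_eq_iff_index_eq[OF A(2)] idx(1) n(1) idx_cong by metis
  have idx_Suc: "idx (i + 1) = (idx i + 1) mod n" for i
  proof -
    have "int (idx (i + 1)) = int ((idx i + 1) mod n)"
      by (simp add: idx(2) zmod_int mod_simps add.commute)
    then show ?thesis by simp
  qed
  have "cyclic_path P (int n) a d"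
  proof
    show "5 < int n" using n by simp
    show "a (i mod int n) = a i" for i by (simp add: a_def idx_def)
    show "i mod int n = j mod int n" if "a i = a j" for i j by (rule a_inject[OF that])
    show "cell (a i) \<in> P" for i unfolding cell_a using A n idx(1) by auto
    show "a (i + 1) = (fst (a i) + fst (d i), snd (a i) + snd (d i))" for i
      by (simp add: d_def)
    show "d i \<in> unit_vectors" for i
    proof -
      have "a i \<noteq> a (i + 1)"
      proof
        assume "a i = a (i + 1)"
        then have "int n dvd i - (i + 1)" using a_inject mod_eq_dvd_iff by metis
        then show False using n zdvd_imp_le[of "int n" 1] by simp
      qed
      moreover have "edge_of (cell (a i) \<inter> cell (a (i + 1))) (cell (a i))"
        unfolding cell_a idx_Suc using edges idx(1) by blast
      ultimately show ?thesis
        unfolding d_def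
        using shared_edge_step[of "fst (a i)" "snd (a i)" "fst (a (i + 1))" "snd (a (i + 1))"] by simp
    qed
    show "(j - i) mod int n \<in> {0, 1, 2, int n - 1, int n - 2}"
      if "cell (a i) \<inter> cell (a j) \<noteq> {}" for i j
    proof -
      have "vertices {A ! idx i} \<inter> vertices {A ! idx j} \<noteq> {}"
        using that by (simp add: vertices_def cell_a)
      then have "idx j \<in> {(idx i + n - 2) mod n, (idx i + n - 1) mod n, idx i, (idx i + 1) mod n, (idx i + 2) mod n}"
        using far idx(1) by meson
      \<comment> \<open>Turns an offset between list positions into a difference of integer
        indices.\<close>
      moreover have "(j - i) mod int n = k mod int n" if "int (idx j) = (int (idx i) + k) mod int n" for k
      proof -
        have "j mod int n = (i + k) mod int n" using that by (simp add: idx(2) mod_simps)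
        then have "(j - i) mod int n = (i + k - i) mod int n" by (rule mod_diff_cong) simp
        then show ?thesis by simp
      qed
      note shift = this
      consider "idx j = (idx i + n - 2) mod n" | "idx j = (idx i + n - 1) mod n" | "idx j = idx i"
        | "idx j = (idx i + 1) mod n" | "idx j = (idx i + 2) mod n"
        using calculation by blast
      then show ?thesis
      proof cases
        case 1
        then have "int (idx j) = (int (idx i) + (int n - 2)) mod int n"
          using n by (simp add: zmod_int of_nat_diff algebra_simps)
        moreover have "(int n - 2) mod int n = int n - 2"
          by (rule mod_pos_pos_trivial) (use n in auto)
        ultimately have "(j - i) mod int n = int n - 2" by (rule trans[OF shift])
        then show ?thesis by blast
      next
        case 2
        then have "int (idx j) = (int (idx i) + (int n - 1)) mod int n"
          using n by (simp add: zmod_int of_nat_diff algebra_simps)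
        moreover have "(int n - 1) mod int n = int n - 1"
          by (rule mod_pos_pos_trivial) (use n in auto)
        ultimately have "(j - i) mod int n = int n - 1" by (rule trans[OF shift])
        then show ?thesis by blast
      next
        case 3
        then have "int (idx j) = (int (idx i) + 0) mod int n" using idx by simp
        from shift[OF this] show ?thesis by simp
      next
        case 4
        then have "int (idx j) = (int (idx i) + 1) mod int n" by (simp add: zmod_int add.commute)
        from shift[OF this] show ?thesis using n by simp
      next
        case 5
        then have "int (idx j) = (int (idx i) + 2) mod int n" by (simp add: zmod_int add.commute)
        from shift[OF this] show ?thesis using n by simp
      qed
    qed
  qed
  then show ?thesis unfolding card by blast
qed

text \<open>The minor \<open>g\<close> may be the negative of the desired binomial. The statement
  keeps what is independent of the sign: the monomials, and membership of the binomial in any ideal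
  containing \<open>g\<close>.\<close>

lemma opposite_corners_inner_minor:
  assumes "opposite_corners P p q r s" "quadric p q \<noteq> quadric r s"
  shows "\<exists>g\<in>inner_minors P. Poly_Mapping.keys g = {quadric p q, quadric r s} \<and>
    (\<forall>I. poly_ideal V I \<longrightarrow> g \<in> I \<longrightarrow>
      Poly_Mapping.single (quadric p q) 1 - Poly_Mapping.single (quadric r s) (1 :: 'k::field) \<in> I)"
proof -
  have quadric_cong: "quadric p q = quadric a b" if "{p, q} = {a, b}" for a b p q :: point
    using that quadric_commute[of p q] by (auto simp: doubleton_eq_iff)
  obtain a b where inner: "inner_interval P a b"
    and cases: "{p, q} = {a, b} \<and> {r, s} = {(fst a, snd b), (fst b, snd a)} \<or>
      {r, s} = {a, b} \<and> {p, q} = {(fst a, snd b), (fst b, snd a)}"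
    using assms(1) unfolding opposite_corners_def by blast
  define g :: "(point, 'k) mpoly" where
    "g = var a * var b - var (fst a, snd b) * var (fst b, snd a)"
  define f :: "(point, 'k) mpoly" where
    "f = Poly_Mapping.single (quadric p q) 1 - Poly_Mapping.single (quadric r s) 1"
  have "g \<in> inner_minors P" unfolding g_def inner_minors_def using inner by blast
  moreover have gf: "g = f \<or> g = - f"
    using cases
  proof (elim disjE conjE)
    assume "{p, q} = {a, b}" "{r, s} = {(fst a, snd b), (fst b, snd a)}"
    then show ?thesis
      using quadric_cong[of a b p q] quadric_cong[of "(fst a, snd b)" "(fst b, snd a)" r s]
      by (simp add: g_def f_def var_mult_var)
  next
    assume "{r, s} = {a, b}" "{p, q} = {(fst a, snd b), (fst b, snd a)}"
    then show ?thesis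
      using quadric_cong[of a b r s] quadric_cong[of "(fst a, snd b)" "(fst b, snd a)" p q]
      by (simp add: g_def f_def var_mult_var)
  qed
  moreover have "Poly_Mapping.keys g = {quadric p q, quadric r s}"
  proof -
    have "Poly_Mapping.keys (- f) = Poly_Mapping.keys f" by (auto simp: in_keys_iff)
    moreover have "Poly_Mapping.keys f = {quadric p q, quadric r s}"
      unfolding f_def by (rule keys_binomial[OF assms(2)])
    ultimately show ?thesis using gf by metis
  qed
  moreover have "f \<in> I" if "poly_ideal V I" "g \<in> I" for I
    using gf poly_ideal.uminus[OF that] that(2) by auto
  ultimately show ?thesis unfolding f_def by blast
qed

theorem theorem4p8:
  fixes P :: "point set set"
  assumes "closed_path P"
  shows "konig_type (vertices P) (polyomino_ideal P :: (point, 'k::field) mpoly set)"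
proof -
  let ?V = "vertices P" and ?I = "polyomino_ideal P :: (point, 'k) mpoly set"
  have P: "finite P" "P \<subseteq> range cell" using assms by (simp_all add: closed_path_def polyomino_def)
  define n where "n = card P"
  obtain a d where "cyclic_path P (int n) a d" using closed_path_cyclic[OF assms] n_def by blast
  then interpret cyclic_path P "int n" a d .
  obtain i where i: "spare i = carried (i - 2)" using spare_is_carried by blast
  have small: "k = l" if "(i + int k) mod int n = (i + int l) mod int n" "k < n" "l < n" for k l
    using not_cong_small[OF that(1)] that(2,3) by simp
  have small': "k = l" if "(i + int k - 1) mod int n = (i + int l - 1) mod int n" "k < n" "l < n" for k l
    using not_cong_small[OF that(1)] that(2,3) by simp
  define C where "C k = carried (i + int k)" for k
  have inj_C: "inj_on C {..<n}"
  proof (rule inj_onI)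
    fix k l assume "k \<in> {..<n}" "l \<in> {..<n}" "C k = C l"
    then show "k = l" using small[OF carried_inject] unfolding C_def by blast
  qed
  \<comment> \<open>With \<open>2 * n\<close> for all other vertices, two carried ones together
    weigh less than a single matched one.\<close>
  define \<omega> where "\<omega> v = (if v \<in> C ` {..<n} then n - 1 - inv_into {..<n} C v else 2 * n)" for v
  have \<omega>_C: "\<omega> (C k) = n - 1 - k" if "k < n" for k
    using that inv_into_f_f[OF inj_C] by (simp add: \<omega>_def)
  have \<omega>_matched: "\<omega> (matched j) = 2 * n" for j
  proof -
    have "matched j \<notin> C ` {..<n}" unfolding C_def using carried_neq_matched by (metis imageE)
    then show ?thesis by (simp add: \<omega>_def)
  qed
  have \<omega>_le: "\<omega> v \<le> 2 * n" for v by (auto simp: \<omega>_def)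
  define u where "u k = quadric (carried (i + int k - 1)) (matched (i + int k))" for k
  define w where "w k = quadric (carried (i + int k)) (spare (i + int k))" for k
  let ?W = "weight_degree \<omega>"
  have less: "?W (w k) < ?W (u k)" if k: "k < n" for k
  proof (cases k)
    case 0
    have n6: "6 \<le> n" using n by simp
    \<comment> \<open>The cut: the preceding carried vertex has weight 0 here and cannot decide. But
      the spare vertex is carried too, with weight 1, so the other monomial has weight only
      \<open>n\<close>.\<close>
    have "carried (i - 2) = C (n - 2)"
      unfolding C_def by (rule carried_cong) (use n6 in \<open>simp add: mod_eq_dvd_iff of_nat_diff\<close>)
    then have "?W (w 0) = n - 1 + (n - 1 - (n - 2))"
      using \<omega>_C[of 0] \<omega>_C[of "n - 2"] n6 i by (simp add: w_def weight_degree_quadric C_def)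
    also have "\<dots> < 2 * n" using n6 by simp
    also have "\<dots> \<le> ?W (u 0)" by (simp add: u_def weight_degree_quadric \<omega>_matched)
    finally show ?thesis using 0 by simp
  next
    case (Suc l)
    \<comment> \<open>Away from the cut the spare vertex may be as heavy as the matched one; the
      carried vertices decide, as their weights drop by one at each cell.\<close>
    have "?W (w k) \<le> (n - 1 - k) + 2 * n"
      using \<omega>_C[OF k] \<omega>_le by (simp add: w_def weight_degree_quadric C_def)
    also have "\<dots> < (n - 1 - l) + 2 * n" using Suc k by simp
    also have "\<dots> = ?W (u k)"
      using \<omega>_C[of l] Suc k by (simp add: u_def weight_degree_quadric \<omega>_matched C_def add.assoc)
    finally show ?thesis .
  qed
  have "\<exists>g\<in>inner_minors P. Poly_Mapping.keys g = {u k, w k} \<and> (\<forall>I. poly_ideal ?V I \<longrightarrow> g \<in> I \<longrightarrow>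
      Poly_Mapping.single (u k) 1 - Poly_Mapping.single (w k) (1 :: 'k) \<in> I)" if "k < n" for k
    using opposite_corners_inner_minor[OF opposite_corners_matched[of "i + int k"], where V = ?V and ?'k = 'k]
      less[OF that] unfolding u_def w_def by fastforce
  then obtain g where g: "\<And>k. k < n \<Longrightarrow> g k \<in> inner_minors P"
    "\<And>k. k < n \<Longrightarrow> Poly_Mapping.keys (g k) = {u k, w k}"
    "\<And>k I. k < n \<Longrightarrow> poly_ideal ?V I \<Longrightarrow> g k \<in> I \<Longrightarrow>
      Poly_Mapping.single (u k) 1 - Poly_Mapping.single (w k) (1 :: 'k) \<in> I"
    by metis
  \<comment> \<open>This is \<open>g k\<close> up to sign, normalised because \<open>leads\<close>
    demands the coefficient 1 at \<open>u k\<close>.\<close>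
  define f where "f k = Poly_Mapping.single (u k) 1 - Poly_Mapping.single (w k) (1 :: 'k)" for k
  have uw: "u k \<in> monomials ?V" "w k \<in> monomials ?V" if "k < n" for k
    using g(1,2)[OF that] inner_minors_in_poly_ring[where ?'k = 'k] by fastforce+
  have f_carrier: "f k \<in> carrier (poly_ring ?V)" if "k < n" for k
    using uw[OF that] keys_diff_subset[of "Poly_Mapping.single (u k) 1" "Poly_Mapping.single (w k) (1 :: 'k)"]
    by (auto simp: f_def)
  have disjoint: "Poly_Mapping.keys (u k) \<inter> Poly_Mapping.keys (u l) = {}"
    if "k < n" "l < n" "k \<noteq> l" for k l
  proof -
    have "carried (i + int k - 1) \<noteq> carried (i + int l - 1)"
      using small'[OF carried_inject] that by blast
    moreover have "matched (i + int k) \<noteq> matched (i + int l)"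
      using small[OF matched_inject] that by blast
    ultimately show ?thesis
      using carried_neq_matched[of "i + int k - 1" "i + int l"] carried_neq_matched[of "i + int l - 1" "i + int k"]
      unfolding u_def keys_quadric by auto
  qed
  have "leading_system ?V ?W n u f"
  proof
    show "leads ?W (u k) (f k)" if "k < n" for k
      using less[OF that] by (simp add: leads_def f_def)
  next
    show "u k \<noteq> 0" for k using keys_quadric[of "carried (i + int k - 1)" "matched (i + int k)"]
      unfolding u_def by (metis insert_not_empty keys_zero)
  qed (use weight_degree_add uw f_carrier disjoint in blast)+
  then interpret binomials: leading_system ?V ?W n u f .
  interpret monomials: leading_system ?V ?W n u "\<lambda>k. Poly_Mapping.single (u k) (1 :: 'k)"
    by unfold_locales
      (use binomials.u_nonzero disjoint uw in \<open>auto simp: weight_degree_add leads_def\<close>)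
  interpret R: cring "poly_ring ?V :: (point, 'k) mpoly ring" by (rule cring_poly_ring)
  have gens: "inner_minors P \<subseteq> ?I"
    unfolding polyomino_ideal_def by (rule R.genideal_self[OF inner_minors_in_poly_ring])
  have "f k \<in> ?I" if "k < n" for k
    unfolding f_def using g(1)[OF that] gens
    by (intro g(3)[OF that] poly_ideal.intro ideal_polyomino_ideal) blast
  then have "set (map f [0..<n]) \<subseteq> ?I" by auto
  then have "enat n \<le> ideal_height (poly_ring ?V) ?I"
    using R.ideal_height_ge_regular_sequence[OF binomials.regular_sequence_leading_system, of ?I] by auto
  then have height: "ideal_height (poly_ring ?V) ?I = enat n"
    using ideal_height_polyomino_ideal_le[OF P, where ?'k = 'k] unfolding n_def by (rule antisym[rotated])
  have initial: "initial_monomial (weight_order ?V \<omega>) (g k) = Poly_Mapping.single (u k) 1" if "k < n" for k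
    using g(2) uw less that by (intro initial_monomial_weight_order) auto
  \<comment> \<open>Equal generators would share their initial monomial, although the
    \<open>u k\<close> have disjoint variables.\<close>
  have "distinct (map g [0..<n])"
  proof -
    have "k = l" if "k < n" "l < n" "g k = g l" for k l
    proof (rule ccontr)
      assume "k \<noteq> l"
      have "Poly_Mapping.single (u k) (1 :: 'k) = Poly_Mapping.single (u l) 1"
        using initial[OF that(1)] initial[OF that(2)] that(3) by simp
      then have "u k = u l" by (metis keys_single one_neq_zero singleton_inject)
      then show False using disjoint[OF that(1,2) \<open>k \<noteq> l\<close>] by (simp add: u_def)
    qed
    then show ?thesis by (auto simp: distinct_map inj_on_def)
  qed
  moreover have "regular_sequence (poly_ring ?V) (map (initial_monomial (weight_order ?V \<omega>)) (map g [0..<n]))"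
  proof -
    have map_eq: "map (initial_monomial (weight_order ?V \<omega>)) (map g [0..<n])
      = map (\<lambda>k. Poly_Mapping.single (u k) (1 :: 'k)) [0..<n]"
      using initial by simp
    show ?thesis unfolding map_eq by (rule monomials.regular_sequence_leading_system)
  qed
  ultimately show ?thesis
    unfolding konig_type_def
    using height g(1) minimal_homogeneous_generators_inner_minors[OF P, where ?'k = 'k]
      monomial_order_weight_order[of ?V \<omega>]
    by (intro exI[of _ n] exI[of _ "map g [0..<n]"] exI[of _ "inner_minors P"]
        exI[of _ "weight_order ?V \<omega>"]) auto
qed

end
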